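(* Let $E$ and $L$ be vector bundles of ranks $n$ and $1$ respectively over $X$ such that $\mathrm{Hom}(\mathrm{Hom}(E,L),E)$ has no nonzero global sections. Let $0 \to E \to W \to \mathrm{Hom}(E,L) \to 0$ be a symplectic extension with sheaf of sections $\mathcal{W}_p$, where $p \in \mathrm{Prin}(\mathrm{Hom}(\mathrm{Hom}(E,L),E))$ satisfies ${}^{t}p - p = \overline{\alpha}$ for some $\alpha \in \mathrm{Rat}(\bigwedge(\mathrm{Hom}(E,L),E))$, the symplectic form $\theta$ on $W$ being the restriction to $\mathcal{W}_p \times \mathcal{W}_p$ of $$\underline{\theta}\left((e_1,\phi_1),(e_2,\phi_2)\right) = \phi_1(e_2) - \phi_2(e_1) - \phi_2(\alpha(\phi_1)).$$ Let $G \subset W$ be a vector subbundle of rank $n$ which intersects $E$ generically in rank $0$, and let $q \in \mathrm{Prin}(\mathrm{Hom}(\mathrm{Hom}(E,L),E))$ be the principal part corresponding to $G$: that is, $q = p - \overline{\beta}$, where $\beta \in \mathrm{Rat}(\mathrm{Hom}(\mathrm{Hom}(E,L),E))$ is the unique element such that the sheaf of sections of $G$ is $\mathcal{G} = \underline{\Gamma_\beta} \cap \mathcal{W}_p$ (so that $\mathcal{G} \cong \mathrm{Ker}(q)$ via projection to the sheaf of sections of $\mathrm{Hom}(E,L)$, and $\delta(W) = [q]$). Then the subbundle $G \subset W$ is isotropic with respect to $\theta$ if and only if $q$ is a symmetric principal part, i.e. ${}^{t}q = q$.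
   Context: $X$ is a complex projective smooth curve of genus $g$ with structure sheaf $\mathcal{O}_X$ and function field $K(X)$. For a vector bundle $V$ with sheaf of regular sections $\mathcal{V}$ there is an exact sequence of $\mathcal{O}_X$-modules $0 \to \mathcal{V} \to \underline{\mathrm{Rat}}(V) \to \underline{\mathrm{Prin}}(V) \to 0$, where $\underline{\mathrm{Rat}}(V)$ is the sheaf of rational sections and $\underline{\mathrm{Prin}}(V)$ the sheaf of principal parts with values in $V$; $\mathrm{Rat}(V)$, $\mathrm{Prin}(V)$ are their groups of global sections. $\overline{s}$ denotes the principal part of a rational section $s$, and $[q] \in H^1(X,V)$ the image of $q \in \mathrm{Prin}(V)$ under the connecting map of the exact sequence $0 \to H^0(X,V) \to \mathrm{Rat}(V) \to \mathrm{Prin}(V) \to H^1(X,V) \to 0$. For vector bundles $E,F$, a principal part $q \in \mathrm{Prin}(\mathrm{Hom}(F,E))$ defines a map $q \colon \mathcal{F} \to \underline{\mathrm{Prin}}(E)$: locally lift $q$ to a rational section $\tilde q$ of $\mathrm{Hom}(F,E)$ and put $q(f) = \overline{\tilde q(f)}$. For $p \in \mathrm{Prin}(\mathrm{Hom}(F,E))$, $$\mathcal{W}_p := \left\{ (e,f) \in \underline{\mathrm{Rat}}(E) \oplus \underline{\mathrm{Rat}}(F) : f \text{ is regular and } \overline{e} = p(f) \right\};$$ it is the sheaf of sections of an extension $W$ of $F$ by $E$ with class $\delta(W) = [p] \in H^1(X,\mathrm{Hom}(F,E))$. Here $F = \mathrm{Hom}(E,L)$. $\mathrm{Rat}(\mathrm{Hom}(F,E))$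 is identified with $\mathrm{Hom}_{K(X)}(\mathrm{Rat}(F),\mathrm{Rat}(E))$. For $\beta$ in it, $\Gamma_\beta = \{(\beta(f),f) : f \in \mathrm{Rat}(F)\}$ is its graph and $\underline{\Gamma_\beta}$ the associated constant sheaf on $X$. The map $\beta \mapsto \underline{\Gamma_\beta} \cap \mathcal{W}_p$ is a bijection from $\mathrm{Hom}_{K(X)}(\mathrm{Rat}(F),\mathrm{Rat}(E))$ to the set of vector subbundles of $W$ of rank $\mathrm{rk}\,F$ meeting $E$ in zero at the generic point of $X$. The transpose of a (rational) homomorphism $\gamma \colon \mathrm{Hom}(E,L) \to E$ is determined by $\phi_2(\gamma(\phi_1)) = \phi_1({}^{t}\gamma(\phi_2))$; it induces a transpose on $\mathrm{Prin}(\mathrm{Hom}(\mathrm{Hom}(E,L),E))$. $\bigwedge(\mathrm{Hom}(E,L),E)$ is the bundle of antisymmetric homomorphisms (${}^{t}\gamma = -\gamma$). A subbundle is isotropic if $\theta$ restricts to zero on it. *)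

theory Defs
  imports "HOL-Analysis.Analysis" "HOL-Library.Function_Algebras"
begin

section \<open>Smooth projective curves over the complex numbers\<close>

text \<open>A point of projective space is a line through the origin, minus the origin; the
  dimension of the ambient space is one less than the size of the index type \<open>'k\<close>.\<close>

definition proj_space :: "(complex^'k) set set" where
  "proj_space = {P. \<exists>z. z \<noteq> 0 \<and> P = {c *s z | c. c \<noteq> 0}}"

definition hpoly :: "nat \<Rightarrow> (complex^'k \<Rightarrow> complex) \<Rightarrow> bool" where
  "hpoly d f \<longleftrightarrow> (\<exists>a :: ('k \<Rightarrow> nat) \<Rightarrow> complex.
     f = (\<lambda>z. \<Sum>m | (\<Sum>i\<in>UNIV. m i) = d. a m * (\<Prod>i\<in>UNIV. (z $ i) ^ m i)))"

definition zclosed :: "(complex^'k) set set \<Rightarrow> bool" where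
  "zclosed Z \<longleftrightarrow> (\<exists>S. (\<forall>f\<in>S. \<exists>d. hpoly d f) \<and>
     Z = {P \<in> proj_space. \<forall>f\<in>S. \<forall>z\<in>P. f z = 0})"

definition zopen :: "(complex^'k) set set \<Rightarrow> (complex^'k) set set \<Rightarrow> bool" where
  "zopen X U \<longleftrightarrow> (\<exists>Z. zclosed Z \<and> U = X - Z)"

definition zirreducible :: "(complex^'k) set set \<Rightarrow> bool" where
  "zirreducible Z \<longleftrightarrow> Z \<noteq> {} \<and>
     (\<forall>A B. zclosed A \<and> zclosed B \<and> Z \<subseteq> A \<union> B \<longrightarrow> Z \<subseteq> A \<or> Z \<subseteq> B)"

text \<open>Krull dimension at least \<open>r\<close>.\<close>

definition zdim_ge :: "(complex^'k) set set \<Rightarrow> nat \<Rightarrow> bool" where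
  "zdim_ge X r \<longleftrightarrow> (\<exists>Z :: nat \<Rightarrow> (complex^'k) set set.
     (\<forall>i\<le>r. zclosed (Z i) \<and> zirreducible (Z i) \<and> Z i \<subseteq> X) \<and> (\<forall>i<r. Z i \<subset> Z (Suc i)))"

text \<open>Tangent space at \<open>z\<close> of the affine cone over \<open>X\<close>; its dimension is one more than that of the
  embedded projective tangent space at the corresponding point.\<close>

definition cone_tangent_space :: "(complex^'k) set set \<Rightarrow> complex^'k \<Rightarrow> (complex^'k) set" where
  "cone_tangent_space X z = {v. \<forall>d f. hpoly d f \<and> (\<forall>Q\<in>X. \<forall>y\<in>Q. f y = 0) \<longrightarrow>
     deriv (\<lambda>t. f (z + t *s v)) 0 = 0}"

definition smooth_projective_curve :: "(complex^'k) set set \<Rightarrow> bool" where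
  "smooth_projective_curve X \<longleftrightarrow> zclosed X \<and> zirreducible X \<and>
     zdim_ge X 1 \<and> \<not> zdim_ge X 2 \<and>
     (\<forall>P\<in>X. \<forall>z\<in>P. vec.dim (cone_tangent_space X z) = 2)"

text \<open>Elements of the structure sheaf over \<open>U\<close> (values off \<open>U\<close> are irrelevant).\<close>

definition regfun :: "(complex^'k) set set \<Rightarrow> (complex^'k) set set \<Rightarrow>
    ((complex^'k) set \<Rightarrow> complex) \<Rightarrow> bool" where
  "regfun X U f \<longleftrightarrow> (\<forall>x\<in>U. \<exists>V. zopen X V \<and> x \<in> V \<and> V \<subseteq> U \<and>
     (\<exists>d g h. hpoly d g \<and> hpoly d h \<and> (\<forall>y\<in>V. \<forall>z\<in>y. h z \<noteq> 0 \<and> f y = g z / h z)))"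


section \<open>Algebraic vector bundles\<close>

text \<open>The fibres are linear subspaces of a complex vector space with scalar multiplication
  \<open>smul\<close>. The algebraic structure is an atlas \<open>triv\<close> of local trivialisations \<open>(U, \<phi>)\<close>, where
  \<open>\<phi> x\<close> sends a vector of the fibre over \<open>x \<in> U\<close> to its coordinates, indexed by \<open>{..<rk}\<close>.\<close>

record ('x, 'v) vbundle =
  rk :: nat
  smul :: "complex \<Rightarrow> 'v \<Rightarrow> 'v"
  fib :: "'x \<Rightarrow> 'v set"
  triv :: "('x set \<times> ('x \<Rightarrow> 'v \<Rightarrow> nat \<Rightarrow> complex)) set"

definition coords :: "nat \<Rightarrow> (nat \<Rightarrow> complex) set" where
  "coords n = {c. \<forall>i\<ge>n. c i = 0}"

definition unit_coord :: "nat \<Rightarrow> nat \<Rightarrow> complex" where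
  "unit_coord j = (\<lambda>i. if i = j then 1 else 0)"

definition fibre_iso :: "('x, 'v::ab_group_add) vbundle \<Rightarrow> 'x \<Rightarrow> ('v \<Rightarrow> nat \<Rightarrow> complex) \<Rightarrow> bool" where
  "fibre_iso V x \<phi> \<longleftrightarrow> bij_betw \<phi> (fib V x) (coords (rk V)) \<and>
     (\<forall>u\<in>fib V x. \<forall>v\<in>fib V x. \<forall>i. \<phi> (u + v) i = \<phi> u i + \<phi> v i) \<and>
     (\<forall>c. \<forall>v\<in>fib V x. \<forall>i. \<phi> (smul V c v) i = c * \<phi> v i)"

definition regular_transition :: "(complex^'k) set set \<Rightarrow> ((complex^'k) set, 'v) vbundle \<Rightarrow>
    (complex^'k) set set \<times> ((complex^'k) set \<Rightarrow> 'v \<Rightarrow> nat \<Rightarrow> complex) \<Rightarrow>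
    (complex^'k) set set \<times> ((complex^'k) set \<Rightarrow> 'v \<Rightarrow> nat \<Rightarrow> complex) \<Rightarrow> bool" where
  "regular_transition X V = (\<lambda>(U, \<phi>) (U', \<phi>'). \<exists>g :: nat \<Rightarrow> nat \<Rightarrow> (complex^'k) set \<Rightarrow> complex.
     (\<forall>i<rk V. \<forall>j<rk V. regfun X (U \<inter> U') (g i j)) \<and>
     (\<forall>x\<in>U \<inter> U'. \<forall>v\<in>fib V x. \<forall>i<rk V. \<phi>' x v i = (\<Sum>j<rk V. g i j x * \<phi> x v j)))"

definition local_trivialisation :: "(complex^'k) set set \<Rightarrow>
    ((complex^'k) set, 'v::ab_group_add) vbundle \<Rightarrow>
    (complex^'k) set set \<times> ((complex^'k) set \<Rightarrow> 'v \<Rightarrow> nat \<Rightarrow> complex) \<Rightarrow> bool" where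
  "local_trivialisation X V T \<longleftrightarrow> zopen X (fst T) \<and> (\<forall>x\<in>fst T. fibre_iso V x (snd T x)) \<and>
     (\<forall>T'\<in>triv V. regular_transition X V T T' \<and> regular_transition X V T' T)"

definition vector_bundle :: "(complex^'k) set set \<Rightarrow>
    ((complex^'k) set, 'v::ab_group_add) vbundle \<Rightarrow> bool" where
  "vector_bundle X V \<longleftrightarrow> vector_space (smul V) \<and>
     (\<forall>x\<in>X. module.subspace (smul V) (fib V x)) \<and>
     (\<forall>T\<in>triv V. local_trivialisation X V T) \<and>
     (\<forall>x\<in>X. \<exists>T\<in>triv V. x \<in> fst T)"

text \<open>Elements of \<open>fib (hom_bundle V V') x\<close> are linear maps between the fibres at \<open>x\<close>, extended by
  zero to the whole type. The coordinates of such a map are its matrix entries: with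
  \<open>n = rk V\<close>, the entry in row \<open>i\<close> and column \<open>j\<close> has index \<open>i * n + j\<close>.\<close>

definition hom_bundle :: "('x, 'v::ab_group_add) vbundle \<Rightarrow> ('x, 'w::ab_group_add) vbundle \<Rightarrow>
    ('x, 'v \<Rightarrow> 'w) vbundle" where
  "hom_bundle V V' = \<lparr>
     rk = rk V' * rk V,
     smul = (\<lambda>c f v. smul V' c (f v)),
     fib = (\<lambda>x. {f. (\<forall>v\<in>fib V x. f v \<in> fib V' x) \<and>
                    (\<forall>u\<in>fib V x. \<forall>v\<in>fib V x. f (u + v) = f u + f v) \<and>
                    (\<forall>c. \<forall>v\<in>fib V x. f (smul V c v) = smul V' c (f v)) \<and>
                    (\<forall>v. v \<notin> fib V x \<longrightarrow> f v = 0)}),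
     triv = {(U \<inter> U', \<lambda>x f k. if k < rk V' * rk V
                then \<psi> x (f (inv_into (fib V x) (\<phi> x) (unit_coord (k mod rk V)))) (k div rk V)
                else 0) | U \<phi> U' \<psi>. (U, \<phi>) \<in> triv V \<and> (U', \<psi>) \<in> triv V'} \<rparr>"

text \<open>Regular sections of \<open>V\<close> over \<open>U\<close> (values off \<open>U\<close> are irrelevant).\<close>

definition regsec :: "(complex^'k) set set \<Rightarrow> ((complex^'k) set, 'v::ab_group_add) vbundle \<Rightarrow>
    (complex^'k) set set \<Rightarrow> ((complex^'k) set \<Rightarrow> 'v) \<Rightarrow> bool" where
  "regsec X V U s \<longleftrightarrow> (\<forall>x\<in>U. s x \<in> fib V x) \<and>
     (\<forall>(U', \<phi>)\<in>triv V. \<forall>i<rk V. regfun X (U \<inter> U') (\<lambda>x. \<phi> x (s x) i))"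

definition subbundle :: "(complex^'k) set set \<Rightarrow> ((complex^'k) set, 'v::ab_group_add) vbundle \<Rightarrow>
    nat \<Rightarrow> ((complex^'k) set \<Rightarrow> 'v set) \<Rightarrow> bool" where
  "subbundle X V r G \<longleftrightarrow> r \<le> rk V \<and>
     (\<forall>x\<in>X. \<exists>U \<phi>. x \<in> U \<and> local_trivialisation X V (U, \<phi>) \<and>
        (\<forall>y\<in>U. G y = {v \<in> fib V y. \<phi> y v \<in> coords r}))"

definition exact_sequence :: "(complex^'k) set set \<Rightarrow>
    ((complex^'k) set, 'e::ab_group_add) vbundle \<Rightarrow> ((complex^'k) set, 'w::ab_group_add) vbundle \<Rightarrow>
    ((complex^'k) set, 'f::ab_group_add) vbundle \<Rightarrow>
    ((complex^'k) set \<Rightarrow> 'e \<Rightarrow> 'w) \<Rightarrow> ((complex^'k) set \<Rightarrow> 'w \<Rightarrow> 'f) \<Rightarrow> bool" where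
  "exact_sequence X E W F \<iota> \<pi> \<longleftrightarrow>
     regsec X (hom_bundle E W) X \<iota> \<and> regsec X (hom_bundle W F) X \<pi> \<and>
     (\<forall>x\<in>X. inj_on (\<iota> x) (fib E x) \<and>
        \<iota> x ` fib E x = {w \<in> fib W x. \<pi> x w = 0} \<and> \<pi> x ` fib W x = fib F x)"

definition isotropic :: "(complex^'k) set set \<Rightarrow> ((complex^'k) set \<Rightarrow> 'w \<Rightarrow> 'w \<Rightarrow> 'l::zero) \<Rightarrow>
    ((complex^'k) set \<Rightarrow> 'w set) \<Rightarrow> bool" where
  "isotropic X \<theta> G \<longleftrightarrow> (\<forall>x\<in>X. \<forall>u\<in>G x. \<forall>v\<in>G x. \<theta> x u v = 0)"

definition symplectic_form :: "(complex^'k) set set \<Rightarrow>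
    ((complex^'k) set, 'w::ab_group_add) vbundle \<Rightarrow> ((complex^'k) set, 'l::ab_group_add) vbundle \<Rightarrow>
    ((complex^'k) set \<Rightarrow> 'w \<Rightarrow> 'w \<Rightarrow> 'l) \<Rightarrow> bool" where
  "symplectic_form X W L \<theta> \<longleftrightarrow> regsec X (hom_bundle W (hom_bundle W L)) X \<theta> \<and>
     (\<forall>x\<in>X. \<forall>w\<in>fib W x. \<theta> x w w = 0) \<and>
     (\<forall>x\<in>X. \<forall>w\<in>fib W x. w \<noteq> 0 \<longrightarrow> (\<exists>w'\<in>fib W x. \<theta> x w w' \<noteq> 0))"

definition symplectic_extension :: "(complex^'k) set set \<Rightarrow>
    ((complex^'k) set, 'e::ab_group_add) vbundle \<Rightarrow> ((complex^'k) set, 'l::ab_group_add) vbundle \<Rightarrow>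
    ((complex^'k) set, 'w::ab_group_add) vbundle \<Rightarrow>
    ((complex^'k) set \<Rightarrow> 'e \<Rightarrow> 'w) \<Rightarrow> ((complex^'k) set \<Rightarrow> 'w \<Rightarrow> 'e \<Rightarrow> 'l) \<Rightarrow>
    ((complex^'k) set \<Rightarrow> 'w \<Rightarrow> 'w \<Rightarrow> 'l) \<Rightarrow> bool" where
  "symplectic_extension X E L W \<iota> \<pi> \<theta> \<longleftrightarrow> vector_bundle X W \<and>
     exact_sequence X E W (hom_bundle E L) \<iota> \<pi> \<and>
     symplectic_form X W L \<theta> \<and> isotropic X \<theta> (\<lambda>x. \<iota> x ` fib E x)"


section \<open>Rational sections\<close>

text \<open>A rational section is a germ at the generic point: a class of sections, each regular on some
  nonempty open set, modulo agreement on a nonempty open set. The sheaf of rational sections is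
  constant, so that the sections of a sheaf over a nonempty open set are regarded as elements of
  \<open>Rat\<close>.\<close>

definition ratrep :: "(complex^'k) set set \<Rightarrow> ((complex^'k) set, 'v::ab_group_add) vbundle \<Rightarrow>
    ((complex^'k) set \<Rightarrow> 'v) set" where
  "ratrep X V = {s. \<exists>U. zopen X U \<and> U \<noteq> {} \<and> regsec X V U s}"

definition rclass :: "(complex^'k) set set \<Rightarrow> ((complex^'k) set, 'v::ab_group_add) vbundle \<Rightarrow>
    ((complex^'k) set \<Rightarrow> 'v) \<Rightarrow> ((complex^'k) set \<Rightarrow> 'v) set" where
  "rclass X V s = {t \<in> ratrep X V. \<exists>U. zopen X U \<and> U \<noteq> {} \<and> (\<forall>x\<in>U. s x = t x)}"

definition Rat :: "(complex^'k) set set \<Rightarrow> ((complex^'k) set, 'v::ab_group_add) vbundle \<Rightarrow>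
    ((complex^'k) set \<Rightarrow> 'v) set set" where
  "Rat X V = rclass X V ` ratrep X V"

text \<open>Pointwise operations on rational sections, with values in the bundle \<open>V\<close>.\<close>

definition rmap :: "(complex^'k) set set \<Rightarrow> ((complex^'k) set, 'v::ab_group_add) vbundle \<Rightarrow>
    ((complex^'k) set \<Rightarrow> 'a \<Rightarrow> 'v) \<Rightarrow> ((complex^'k) set \<Rightarrow> 'a) set \<Rightarrow>
    ((complex^'k) set \<Rightarrow> 'v) set" where
  "rmap X V h A = (\<Union>s\<in>A. rclass X V (\<lambda>x. h x (s x)))"

definition rmap2 :: "(complex^'k) set set \<Rightarrow> ((complex^'k) set, 'v::ab_group_add) vbundle \<Rightarrow>
    ((complex^'k) set \<Rightarrow> 'a \<Rightarrow> 'b \<Rightarrow> 'v) \<Rightarrow> ((complex^'k) set \<Rightarrow> 'a) set \<Rightarrow>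
    ((complex^'k) set \<Rightarrow> 'b) set \<Rightarrow> ((complex^'k) set \<Rightarrow> 'v) set" where
  "rmap2 X V h A B = (\<Union>s\<in>A. \<Union>t\<in>B. rclass X V (\<lambda>x. h x (s x) (t x)))"

definition rplus :: "(complex^'k) set set \<Rightarrow> ((complex^'k) set, 'v::ab_group_add) vbundle \<Rightarrow>
    ((complex^'k) set \<Rightarrow> 'v) set \<Rightarrow> ((complex^'k) set \<Rightarrow> 'v) set \<Rightarrow>
    ((complex^'k) set \<Rightarrow> 'v) set" where
  "rplus X V = rmap2 X V (\<lambda>x u v. u + v)"

definition rdiff :: "(complex^'k) set set \<Rightarrow> ((complex^'k) set, 'v::ab_group_add) vbundle \<Rightarrow>
    ((complex^'k) set \<Rightarrow> 'v) set \<Rightarrow> ((complex^'k) set \<Rightarrow> 'v) set \<Rightarrow>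
    ((complex^'k) set \<Rightarrow> 'v) set" where
  "rdiff X V = rmap2 X V (\<lambda>x u v. u - v)"

definition rscale :: "(complex^'k) set set \<Rightarrow> ((complex^'k) set, 'v::ab_group_add) vbundle \<Rightarrow>
    ((complex^'k) set \<Rightarrow> complex) \<Rightarrow> ((complex^'k) set \<Rightarrow> 'v) set \<Rightarrow>
    ((complex^'k) set \<Rightarrow> 'v) set" where
  "rscale X V h = rmap X V (\<lambda>x v. smul V (h x) v)"

text \<open>Evaluation of a rational section of \<open>hom_bundle V' V\<close> on a rational section of \<open>V'\<close>.\<close>

definition rapp :: "(complex^'k) set set \<Rightarrow> ((complex^'k) set, 'v::ab_group_add) vbundle \<Rightarrow>
    ((complex^'k) set \<Rightarrow> 'a \<Rightarrow> 'v) set \<Rightarrow> ((complex^'k) set \<Rightarrow> 'a) set \<Rightarrow>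
    ((complex^'k) set \<Rightarrow> 'v) set" where
  "rapp X V = rmap2 X V (\<lambda>x \<gamma> v. \<gamma> v)"

definition fib_transpose :: "('x, 'e::ab_group_add) vbundle \<Rightarrow> ('x, 'l::ab_group_add) vbundle \<Rightarrow>
    'x \<Rightarrow> (('e \<Rightarrow> 'l) \<Rightarrow> 'e) \<Rightarrow> ('e \<Rightarrow> 'l) \<Rightarrow> 'e" where
  "fib_transpose E L x \<gamma> = (THE \<delta>. \<delta> \<in> fib (hom_bundle (hom_bundle E L) E) x \<and>
     (\<forall>\<phi>1\<in>fib (hom_bundle E L) x. \<forall>\<phi>2\<in>fib (hom_bundle E L) x. \<phi>2 (\<gamma> \<phi>1) = \<phi>1 (\<delta> \<phi>2)))"

definition rtranspose :: "(complex^'k) set set \<Rightarrow> ((complex^'k) set, 'e::ab_group_add) vbundle \<Rightarrow>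
    ((complex^'k) set, 'l::ab_group_add) vbundle \<Rightarrow>
    ((complex^'k) set \<Rightarrow> ('e \<Rightarrow> 'l) \<Rightarrow> 'e) set \<Rightarrow> ((complex^'k) set \<Rightarrow> ('e \<Rightarrow> 'l) \<Rightarrow> 'e) set" where
  "rtranspose X E L = rmap X (hom_bundle (hom_bundle E L) E) (fib_transpose E L)"

text \<open>Rational sections of the bundle of antisymmetric homomorphisms.\<close>

definition RatAlt :: "(complex^'k) set set \<Rightarrow> ((complex^'k) set, 'e::ab_group_add) vbundle \<Rightarrow>
    ((complex^'k) set, 'l::ab_group_add) vbundle \<Rightarrow>
    ((complex^'k) set \<Rightarrow> ('e \<Rightarrow> 'l) \<Rightarrow> 'e) set set" where
  "RatAlt X E L = {\<alpha> \<in> Rat X (hom_bundle (hom_bundle E L) E).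
     rtranspose X E L \<alpha> = rmap X (hom_bundle (hom_bundle E L) E) (\<lambda>x \<gamma>. - \<gamma>) \<alpha>}"

text \<open>The sheaf of regular sections of \<open>V\<close> over \<open>U\<close> and its stalk at \<open>x\<close>, inside \<open>Rat X V\<close>.\<close>

definition secs :: "(complex^'k) set set \<Rightarrow> ((complex^'k) set, 'v::ab_group_add) vbundle \<Rightarrow>
    (complex^'k) set set \<Rightarrow> ((complex^'k) set \<Rightarrow> 'v) set set" where
  "secs X V U = rclass X V ` {s. regsec X V U s}"

definition stalk :: "(complex^'k) set set \<Rightarrow> ((complex^'k) set, 'v::ab_group_add) vbundle \<Rightarrow>
    (complex^'k) set \<Rightarrow> ((complex^'k) set \<Rightarrow> 'v) set set" where
  "stalk X V x = (\<Union>U\<in>{U. zopen X U \<and> x \<in> U}. secs X V U)"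

definition rgraph :: "(complex^'k) set set \<Rightarrow> ((complex^'k) set, 'e::ab_group_add) vbundle \<Rightarrow>
    ((complex^'k) set, 'f::ab_group_add) vbundle \<Rightarrow> ((complex^'k) set \<Rightarrow> 'f \<Rightarrow> 'e) set \<Rightarrow>
    (((complex^'k) set \<Rightarrow> 'e) set \<times> ((complex^'k) set \<Rightarrow> 'f) set) set" where
  "rgraph X E F \<beta> = {(rapp X E \<beta> f, f) | f. f \<in> Rat X F}"


section \<open>Principal parts\<close>

text \<open>The class of \<open>A\<close> in the stalk at \<open>x\<close> of the quotient of the sheaf of rational sections by the
  sheaf of regular sections.\<close>

definition pgerm :: "(complex^'k) set set \<Rightarrow> ((complex^'k) set, 'v::ab_group_add) vbundle \<Rightarrow>
    (complex^'k) set \<Rightarrow> ((complex^'k) set \<Rightarrow> 'v) set \<Rightarrow> ((complex^'k) set \<Rightarrow> 'v) set set" where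
  "pgerm X V x A = {B \<in> Rat X V. rdiff X V B A \<in> stalk X V x}"

text \<open>Global sections of the quotient sheaf: families of germs that locally lift to rational
  sections.\<close>

definition Prin :: "(complex^'k) set set \<Rightarrow> ((complex^'k) set, 'v::ab_group_add) vbundle \<Rightarrow>
    ((complex^'k) set \<Rightarrow> ((complex^'k) set \<Rightarrow> 'v) set set) set" where
  "Prin X V = {q \<in> extensional X. \<forall>x\<in>X. \<exists>U. zopen X U \<and> x \<in> U \<and>
     (\<exists>A\<in>Rat X V. \<forall>y\<in>U. q y = pgerm X V y A)}"

definition ppart :: "(complex^'k) set set \<Rightarrow> ((complex^'k) set, 'v::ab_group_add) vbundle \<Rightarrow>
    ((complex^'k) set \<Rightarrow> 'v) set \<Rightarrow> (complex^'k) set \<Rightarrow> ((complex^'k) set \<Rightarrow> 'v) set set" where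
  "ppart X V A = (\<lambda>x\<in>X. pgerm X V x A)"

text \<open>In the next three definitions the union runs over all lifts of the germs involved; it is
  the common value obtained from any one of them (for \<open>papp\<close>, at points where \<open>f\<close> is regular).\<close>

definition pdiff :: "(complex^'k) set set \<Rightarrow> ((complex^'k) set, 'v::ab_group_add) vbundle \<Rightarrow>
    ((complex^'k) set \<Rightarrow> ((complex^'k) set \<Rightarrow> 'v) set set) \<Rightarrow>
    ((complex^'k) set \<Rightarrow> ((complex^'k) set \<Rightarrow> 'v) set set) \<Rightarrow>
    (complex^'k) set \<Rightarrow> ((complex^'k) set \<Rightarrow> 'v) set set" where
  "pdiff X V p q = (\<lambda>x\<in>X. \<Union>A\<in>p x. \<Union>B\<in>q x. pgerm X V x (rdiff X V A B))"

definition ptranspose :: "(complex^'k) set set \<Rightarrow> ((complex^'k) set, 'e::ab_group_add) vbundle \<Rightarrow>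
    ((complex^'k) set, 'l::ab_group_add) vbundle \<Rightarrow>
    ((complex^'k) set \<Rightarrow> ((complex^'k) set \<Rightarrow> ('e \<Rightarrow> 'l) \<Rightarrow> 'e) set set) \<Rightarrow>
    (complex^'k) set \<Rightarrow> ((complex^'k) set \<Rightarrow> ('e \<Rightarrow> 'l) \<Rightarrow> 'e) set set" where
  "ptranspose X E L p =
     (\<lambda>x\<in>X. \<Union>A\<in>p x. pgerm X (hom_bundle (hom_bundle E L) E) x (rtranspose X E L A))"

definition papp :: "(complex^'k) set set \<Rightarrow> ((complex^'k) set, 'e::ab_group_add) vbundle \<Rightarrow>
    ((complex^'k) set \<Rightarrow> ((complex^'k) set \<Rightarrow> 'f \<Rightarrow> 'e) set set) \<Rightarrow> ((complex^'k) set \<Rightarrow> 'f) set \<Rightarrow>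
    (complex^'k) set \<Rightarrow> ((complex^'k) set \<Rightarrow> 'e) set set" where
  "papp X E p f = (\<lambda>x\<in>X. \<Union>A\<in>p x. pgerm X E x (rapp X E A f))"


section \<open>Extensions defined by principal parts\<close>

text \<open>Sections over a nonempty open set \<open>U\<close> of the sheaf \<open>\<W>\<^sub>p\<close>.\<close>

definition Wsheaf :: "(complex^'k) set set \<Rightarrow> ((complex^'k) set, 'e::ab_group_add) vbundle \<Rightarrow>
    ((complex^'k) set, 'f::ab_group_add) vbundle \<Rightarrow>
    ((complex^'k) set \<Rightarrow> ((complex^'k) set \<Rightarrow> 'f \<Rightarrow> 'e) set set) \<Rightarrow> (complex^'k) set set \<Rightarrow>
    (((complex^'k) set \<Rightarrow> 'e) set \<times> ((complex^'k) set \<Rightarrow> 'f) set) set" where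
  "Wsheaf X E F p U = {(e, f). e \<in> Rat X E \<and> f \<in> secs X F U \<and>
     (\<forall>x\<in>U. ppart X E e x = papp X E p f x)}"

text \<open>\<open>\<Psi>\<close> is an \<open>\<O>\<^sub>X\<close>-linear isomorphism from the sheaf of sections of \<open>W\<close> to \<open>\<W>\<^sub>p\<close>, compatible
  with the maps from \<open>E\<close> and to \<open>F\<close>. As restriction maps are inclusions inside \<open>Rat\<close>, a morphism
  of sheaves is a single function \<open>\<Psi>\<close> on \<open>Rat X W\<close>.\<close>

definition has_sheaf_Wp :: "(complex^'k) set set \<Rightarrow> ((complex^'k) set, 'e::ab_group_add) vbundle \<Rightarrow>
    ((complex^'k) set, 'w::ab_group_add) vbundle \<Rightarrow> ((complex^'k) set, 'f::ab_group_add) vbundle \<Rightarrow>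
    ((complex^'k) set \<Rightarrow> 'e \<Rightarrow> 'w) \<Rightarrow> ((complex^'k) set \<Rightarrow> 'w \<Rightarrow> 'f) \<Rightarrow>
    ((complex^'k) set \<Rightarrow> ((complex^'k) set \<Rightarrow> 'f \<Rightarrow> 'e) set set) \<Rightarrow>
    (((complex^'k) set \<Rightarrow> 'w) set \<Rightarrow>
       ((complex^'k) set \<Rightarrow> 'e) set \<times> ((complex^'k) set \<Rightarrow> 'f) set) \<Rightarrow> bool" where
  "has_sheaf_Wp X E W F \<iota> \<pi> p \<Psi> \<longleftrightarrow>
     (\<forall>U. zopen X U \<and> U \<noteq> {} \<longrightarrow>
        bij_betw \<Psi> (secs X W U) (Wsheaf X E F p U) \<and>
        (\<forall>A\<in>secs X W U. \<forall>B\<in>secs X W U. \<Psi> (rplus X W A B) =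
           (rplus X E (fst (\<Psi> A)) (fst (\<Psi> B)), rplus X F (snd (\<Psi> A)) (snd (\<Psi> B)))) \<and>
        (\<forall>h. regfun X U h \<longrightarrow> (\<forall>A\<in>secs X W U. \<Psi> (rscale X W h A) =
           (rscale X E h (fst (\<Psi> A)), rscale X F h (snd (\<Psi> A))))) \<and>
        (\<forall>e\<in>secs X E U. \<Psi> (rmap X W \<iota> e) = (e, rclass X F (\<lambda>x. 0))) \<and>
        (\<forall>A\<in>secs X W U. snd (\<Psi> A) = rmap X F \<pi> A))"

text \<open>The form \<open>\<phi>\<^sub>1(e\<^sub>2) - \<phi>\<^sub>2(e\<^sub>1) - \<phi>\<^sub>2(\<alpha>(\<phi>\<^sub>1))\<close> on pairs of rational sections.\<close>

definition theta_rat :: "(complex^'k) set set \<Rightarrow> ((complex^'k) set, 'e::ab_group_add) vbundle \<Rightarrow>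
    ((complex^'k) set, 'l::ab_group_add) vbundle \<Rightarrow>
    ((complex^'k) set \<Rightarrow> ('e \<Rightarrow> 'l) \<Rightarrow> 'e) set \<Rightarrow>
    ((complex^'k) set \<Rightarrow> 'e) set \<times> ((complex^'k) set \<Rightarrow> 'e \<Rightarrow> 'l) set \<Rightarrow>
    ((complex^'k) set \<Rightarrow> 'e) set \<times> ((complex^'k) set \<Rightarrow> 'e \<Rightarrow> 'l) set \<Rightarrow>
    ((complex^'k) set \<Rightarrow> 'l) set" where
  "theta_rat X E L \<alpha> = (\<lambda>(e1, \<phi>1) (e2, \<phi>2).
     rdiff X L (rdiff X L (rapp X L \<phi>1 e2) (rapp X L \<phi>2 e1))
       (rapp X L \<phi>2 (rapp X E \<alpha> \<phi>1)))"

text \<open>The form \<open>\<theta>\<close> on \<open>W\<close> is, on sections, the restriction of \<^const>\<open>theta_rat\<close> to \<open>\<W>\<^sub>p \<times> \<W>\<^sub>p\<close>.\<close>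

definition form_restricts :: "(complex^'k) set set \<Rightarrow> ((complex^'k) set, 'e::ab_group_add) vbundle \<Rightarrow>
    ((complex^'k) set, 'l::ab_group_add) vbundle \<Rightarrow> ((complex^'k) set, 'w::ab_group_add) vbundle \<Rightarrow>
    ((complex^'k) set \<Rightarrow> ('e \<Rightarrow> 'l) \<Rightarrow> 'e) set \<Rightarrow>
    (((complex^'k) set \<Rightarrow> 'w) set \<Rightarrow>
       ((complex^'k) set \<Rightarrow> 'e) set \<times> ((complex^'k) set \<Rightarrow> 'e \<Rightarrow> 'l) set) \<Rightarrow>
    ((complex^'k) set \<Rightarrow> 'w \<Rightarrow> 'w \<Rightarrow> 'l) \<Rightarrow> bool" where
  "form_restricts X E L W \<alpha> \<Psi> \<theta> \<longleftrightarrow>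
     (\<forall>U. zopen X U \<and> U \<noteq> {} \<longrightarrow> (\<forall>A\<in>secs X W U. \<forall>B\<in>secs X W U.
        rmap2 X L \<theta> A B = theta_rat X E L \<alpha> (\<Psi> A) (\<Psi> B)))"

definition subsecs :: "(complex^'k) set set \<Rightarrow> ((complex^'k) set, 'w::ab_group_add) vbundle \<Rightarrow>
    ((complex^'k) set \<Rightarrow> 'w set) \<Rightarrow> (complex^'k) set set \<Rightarrow> ((complex^'k) set \<Rightarrow> 'w) set set" where
  "subsecs X W G U = rclass X W ` {s. regsec X W U s \<and> (\<forall>x\<in>U. s x \<in> G x)}"

end

(* Write a section of G generically as (\<beta>(f), f).  By the defining property of the transpose,
   \<theta>((\<beta>(f), f), (\<beta>(g), g)) = g(d(f)) with d = t\<beta> - \<beta> - \<alpha>, where t denotes the transpose.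
   Near a general point p, \<alpha> and \<beta> are regular, so every regular f lifts to G there; hence G is
   generically isotropic iff d = 0, and generic isotropy is isotropy because \<theta> is regular.
   On the other hand tq - q is the principal part of \<alpha> - (t\<beta> - \<beta>) = -d.  So q is symmetric iff d
   is everywhere regular, that is, iff d = 0, as Hom(Hom(E, L), E) has no nonzero global section. *)

theory Submission
  imports Defs
begin

section \<open>The Zariski topology\<close>

text \<open>Rational sections and principal parts are sets of functions on points, so every argument
  passes to representatives: \<open>gen_eq\<close> is equality at the generic point,
  \<open>regular_at\<close> is membership in a stalk, and each operation defined by a union over
  lifts is shown to have a single value. Irreducibility enters through the identity principle:
  regular sections over an open set that agree on a nonempty open set are equal. It carries isotropy
  to the points where \<open>\<alpha>\<close> or \<open>\<beta>\<close> has a pole, and it glues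
  local regular representatives of d into a global section. The other obstacle is that d lives in an
  iterated Hom bundle and contains a transpose given by a definite description. Regularity is
  therefore tested on frames, a condition that is stable under forming Hom, and the transpose is
  identified, using \<open>rk L = 1\<close>, with an explicit formula in a dual frame. To get d = 0
  from isotropy one needs enough sections of G: over an open set where the principal part p also has
  a regular lift, every pair (\<beta>(f), f) with f regular satisfies the condition defining
  \<open>Wsheaf\<close>.\<close>

lemma finite_exponents: "finite {m :: 'k::finite \<Rightarrow> nat. (\<Sum>i\<in>UNIV. m i) = d}"
proof (rule finite_subset)
  show "{m :: 'k \<Rightarrow> nat. (\<Sum>i\<in>UNIV. m i) = d} \<subseteq> PiE UNIV (\<lambda>_. {..d})"
    by (auto intro: member_le_sum)
qed (auto intro: finite_PiE)

lemma hpoly_const: "hpoly 0 (\<lambda>_. c)"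
proof -
  have "{m :: 'a::finite \<Rightarrow> nat. (\<Sum>i\<in>UNIV. m i) = 0} = {\<lambda>_. 0}"
    by auto
  then show ?thesis
    unfolding hpoly_def by (intro exI[of _ "\<lambda>_. c"]) simp
qed

lemma hpoly_add:
  assumes "hpoly d f" "hpoly d g"
  shows "hpoly d (\<lambda>z. f z + g z)"
proof -
  obtain a b where "f = (\<lambda>z. \<Sum>m | (\<Sum>i\<in>UNIV. m i) = d. a m * (\<Prod>i\<in>UNIV. (z $ i) ^ m i))"
    "g = (\<lambda>z. \<Sum>m | (\<Sum>i\<in>UNIV. m i) = d. b m * (\<Prod>i\<in>UNIV. (z $ i) ^ m i))"
    using assms unfolding hpoly_def by blast
  then show ?thesis
    unfolding hpoly_def
    by (intro exI[of _ "\<lambda>m. a m + b m"]) (simp add: sum.distrib algebra_simps)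
qed

text \<open>Cauchy product: \<open>c l\<close> collects the products of coefficients over all pairs
  of exponents with sum \<open>l\<close>, and \<open>sum.group\<close> regroups the double sum along
  \<open>add\<close>.\<close>

lemma hpoly_mult:
  assumes "hpoly d f" "hpoly e g"
  shows "hpoly (d + e) (\<lambda>z. f z * g z)"
proof -
  define M where "M = (\<lambda>d. {m :: 'a \<Rightarrow> nat. (\<Sum>i\<in>UNIV. m i) = d})"
  define mon where "mon = (\<lambda>(m :: 'a \<Rightarrow> nat) (z :: complex^'a). \<Prod>i\<in>UNIV. (z $ i) ^ m i)"
  obtain a b where f: "f = (\<lambda>z. \<Sum>m\<in>M d. a m * mon m z)" and g: "g = (\<lambda>z. \<Sum>m\<in>M e. b m * mon m z)"
    using assms unfolding hpoly_def M_def mon_def by blast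
  have fin: "finite (M d)" for d
    unfolding M_def by (rule finite_exponents)
  define add where "add = (\<lambda>(m, m') (i :: 'a). m i + m' i :: nat)"
  define c where "c = (\<lambda>l. \<Sum>mm | mm \<in> M d \<times> M e \<and> add mm = l. a (fst mm) * b (snd mm))"
  have add: "add ` (M d \<times> M e) \<subseteq> M (d + e)"
    unfolding add_def M_def by (auto simp: sum.distrib)
  have mon: "mon (add mm) z = mon (fst mm) z * mon (snd mm) z" for mm z
    unfolding mon_def add_def by (cases mm) (simp add: power_add prod.distrib)
  have "f z * g z = (\<Sum>l\<in>M (d + e). c l * mon l z)" for z
  proof -
    have "f z * g z = (\<Sum>mm\<in>M d \<times> M e. a (fst mm) * b (snd mm) * mon (add mm) z)"
      unfolding f g mon by (simp add: sum_product sum.cartesian_product case_prod_unfold mult_ac)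
    also have "\<dots> = (\<Sum>l\<in>M (d + e). \<Sum>mm | mm \<in> M d \<times> M e \<and> add mm = l.
                      a (fst mm) * b (snd mm) * mon (add mm) z)"
      by (rule sum.group[symmetric]) (use fin add in auto)
    also have "\<dots> = (\<Sum>l\<in>M (d + e). c l * mon l z)"
      unfolding c_def sum_distrib_right by (intro sum.cong refl) auto
    finally show ?thesis .
  qed
  then show ?thesis
    unfolding hpoly_def M_def mon_def by blast
qed

lemma hpoly_homogeneous:
  assumes "hpoly d f"
  shows "f (c *s z) = c ^ d * f z"
proof -
  obtain a where a: "f = (\<lambda>z. \<Sum>m | (\<Sum>i\<in>UNIV. m i) = d. a m * (\<Prod>i\<in>UNIV. (z $ i) ^ m i))"
    using assms unfolding hpoly_def by blast
  show ?thesis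
    unfolding a sum_distrib_left
  proof (intro sum.cong refl)
    fix m :: "'a \<Rightarrow> nat"
    assume "m \<in> {m. (\<Sum>i\<in>UNIV. m i) = d}"
    then have "(\<Prod>i\<in>UNIV. c ^ m i) = c ^ d"
      by (auto simp: power_sum)
    then show "a m * (\<Prod>i\<in>UNIV. ((c *s z) $ i) ^ m i) = c ^ d * (a m * (\<Prod>i\<in>UNIV. (z $ i) ^ m i))"
      by (simp add: power_mult_distrib prod.distrib)
  qed
qed

lemma proj_space_scaleE:
  assumes "P \<in> proj_space" "z \<in> P" "y \<in> P"
  obtains c where "c \<noteq> 0" "y = c *s z"
proof -
  obtain w where w: "P = {c *s w | c. c \<noteq> 0}"
    using assms(1) unfolding proj_space_def by blast
  obtain a b where "a \<noteq> 0" "z = a *s w" "b \<noteq> 0" "y = b *s w"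
    using assms(2,3) unfolding w by blast
  then show thesis
    by (intro that[of "b / a"]) (auto simp: vector_smult_assoc)
qed

lemma proj_space_nonempty: "P \<in> proj_space \<Longrightarrow> \<exists>z. z \<in> P"
  unfolding proj_space_def by force

text \<open>Two representatives of a point differ by a scalar, which homogeneity turns into a factor
  of the value. Vanishing at a point of projective space is thus independent of the
  representative.\<close>

lemma hpoly_zero_on_point:
  assumes "hpoly d f" "P \<in> proj_space" "z \<in> P" "f z = 0" "y \<in> P"
  shows "f y = 0"
  using assms by (metis hpoly_homogeneous mult_zero_right proj_space_scaleE)

lemma zclosed_Un:
  assumes "zclosed A" "zclosed B"
  shows "zclosed (A \<union> B)"
proof -
  obtain S where S: "\<forall>f\<in>S. \<exists>d. hpoly d f" "A = {P \<in> proj_space. \<forall>f\<in>S. \<forall>z\<in>P. f z = 0}"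
    using assms(1) unfolding zclosed_def by blast
  obtain T where T: "\<forall>f\<in>T. \<exists>d. hpoly d f" "B = {P \<in> proj_space. \<forall>f\<in>T. \<forall>z\<in>P. f z = 0}"
    using assms(2) unfolding zclosed_def by blast
  define R where "R = {\<lambda>z. f z * g z | f g. f \<in> S \<and> g \<in> T}"
  have "\<forall>f\<in>R. \<exists>d. hpoly d f"
    using S(1) T(1) hpoly_mult unfolding R_def by blast
  moreover have "A \<union> B = {P \<in> proj_space. \<forall>f\<in>R. \<forall>z\<in>P. f z = 0}"
  proof (intro set_eqI iffI)
    fix P
    assume "P \<in> A \<union> B"
    then show "P \<in> {P \<in> proj_space. \<forall>f\<in>R. \<forall>z\<in>P. f z = 0}"
      unfolding S(2) T(2) R_def by auto
  next
    fix P
    assume P: "P \<in> {P \<in> proj_space. \<forall>f\<in>R. \<forall>z\<in>P. f z = 0}"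
    show "P \<in> A \<union> B"
    proof (rule ccontr)
      assume "P \<notin> A \<union> B"
      then obtain f z g y where f: "f \<in> S" "z \<in> P" "f z \<noteq> 0" and g: "g \<in> T" "y \<in> P" "g y \<noteq> 0"
        using P unfolding S(2) T(2) by auto
      have fg: "(\<lambda>z. f z * g z) \<in> R"
        unfolding R_def using f(1) g(1) by blast
      have "\<forall>h\<in>R. \<forall>z\<in>P. h z = 0"
        using P by simp
      from bspec[OF this fg] have "f z * g z = 0"
        using f(2) by simp
      \<comment> \<open>The representatives \<open>z\<close> and \<open>y\<close> at which
        \<open>f\<close> and \<open>g\<close> are nonzero may differ; homogeneity carries
        \<open>g\<close> from \<open>y\<close> to \<open>z\<close>.\<close>
      moreover have "g z \<noteq> 0"
        using hpoly_zero_on_point T(1) g f(2) P by blast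
      ultimately show False
        using f(3) by simp
    qed
  qed
  ultimately show ?thesis
    unfolding zclosed_def by blast
qed

lemma zclosed_empty: "zclosed {}"
  unfolding zclosed_def using hpoly_const[of 1] proj_space_nonempty
  by (intro exI[of _ "{\<lambda>_. 1}"]) auto

lemma zclosed_zeros: "hpoly d f \<Longrightarrow> zclosed {P \<in> proj_space. \<forall>z\<in>P. f z = 0}"
  unfolding zclosed_def by (intro exI[of _ "{f}"]) auto

section \<open>Irreducible projective varieties and their open sets\<close>

locale projective_variety =
  fixes X :: "(complex^'k) set set"
  assumes zclosed: "zclosed X" and irreducible: "zirreducible X"
begin

lemma subset_proj_space: "X \<subseteq> proj_space"
  using zclosed unfolding zclosed_def by blast

lemma zopen_self: "zopen X X"
  unfolding zopen_def using zclosed_empty by blast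

lemma nonempty: "X \<noteq> {}"
  using irreducible unfolding zirreducible_def by blast

lemma zopen_subset: "zopen X U \<Longrightarrow> U \<subseteq> X"
  unfolding zopen_def by blast

lemma zopen_Int: "zopen X U \<Longrightarrow> zopen X V \<Longrightarrow> zopen X (U \<inter> V)"
  unfolding zopen_def by (metis Diff_Un zclosed_Un)

text \<open>If the intersection were empty, the complements of \<open>U\<close> and \<open>V\<close>
  would cover \<open>X\<close>, and irreducibility would make one of them all of \<open>X\<close>.
  This is what makes agreement on some nonempty open set a transitive relation.\<close>

lemma zopen_Int_nonempty:
  assumes "zopen X U" "U \<noteq> {}" "zopen X V" "V \<noteq> {}"
  shows "U \<inter> V \<noteq> {}"
proof
  assume "U \<inter> V = {}"
  obtain A B where "zclosed A" "U = X - A" "zclosed B" "V = X - B"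
    using assms unfolding zopen_def by blast
  then show False
    using irreducible assms \<open>U \<inter> V = {}\<close> unfolding zirreducible_def by blast
qed

section \<open>Regular functions\<close>

lemma regfun_cong: "regfun X U f \<Longrightarrow> (\<And>x. x \<in> U \<Longrightarrow> f x = g x) \<Longrightarrow> regfun X U g"
  unfolding regfun_def by (smt (verit) subset_iff)

text \<open>Openness of \<open>V\<close> is built into \<open>regfun X V f\<close>, which supplies
  an open neighbourhood inside \<open>V\<close> at each point.\<close>

lemma regfun_local:
  assumes "\<And>x. x \<in> U \<Longrightarrow> \<exists>V. x \<in> V \<and> V \<subseteq> U \<and> regfun X V f"
  shows "regfun X U f"
  unfolding regfun_def
proof
  fix x
  assume "x \<in> U"
  then obtain V where "x \<in> V" "V \<subseteq> U" "regfun X V f"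
    using assms by blast
  then show "\<exists>V. zopen X V \<and> x \<in> V \<and> V \<subseteq> U \<and>
     (\<exists>d g h. hpoly d g \<and> hpoly d h \<and> (\<forall>y\<in>V. \<forall>z\<in>y. h z \<noteq> 0 \<and> f y = g z / h z))"
    unfolding regfun_def by (meson subset_trans)
qed

lemma regfun_restrict:
  assumes "regfun X U f" "zopen X V" "V \<subseteq> U"
  shows "regfun X V f"
  unfolding regfun_def
proof
  fix x
  assume "x \<in> V"
  then obtain V' d g h where "zopen X V'" "x \<in> V'" "hpoly d g" "hpoly d h"
      "\<forall>y\<in>V'. \<forall>z\<in>y. h z \<noteq> 0 \<and> f y = g z / h z"
    using assms(1,3) unfolding regfun_def by blast
  then show "\<exists>V'. zopen X V' \<and> x \<in> V' \<and> V' \<subseteq> V \<and>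
     (\<exists>d g h. hpoly d g \<and> hpoly d h \<and> (\<forall>y\<in>V'. \<forall>z\<in>y. h z \<noteq> 0 \<and> f y = g z / h z))"
    using \<open>x \<in> V\<close> assms(2) by (intro exI[of _ "V' \<inter> V"] conjI zopen_Int) blast+
qed

lemma regfun_const: "zopen X U \<Longrightarrow> regfun X U (\<lambda>_. c)"
  unfolding regfun_def
  using hpoly_const[of c] hpoly_const[of 1]
  by (intro ballI exI[of _ U] exI[of _ 0] exI[of _ "\<lambda>_. c"] exI[of _ "\<lambda>_. 1"] conjI) auto

text \<open>Common skeleton for sums and products: \<open>F\<close> only has to turn two quotients
  of forms of equal degree into another such quotient, wherever both denominators are
  nonzero.\<close>

lemma regfun_binop:
  assumes "regfun X U f" "regfun X U f'"
    and "\<And>d d' (g :: complex^'k \<Rightarrow> complex) h g' h'. hpoly d g \<Longrightarrow> hpoly d h \<Longrightarrow> hpoly d' g' \<Longrightarrow> hpoly d' h' \<Longrightarrow>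
      \<exists>e k l. hpoly e k \<and> hpoly e l \<and>
        (\<forall>z. h z \<noteq> 0 \<and> h' z \<noteq> 0 \<longrightarrow> l z \<noteq> 0 \<and> F (g z / h z) (g' z / h' z) = k z / l z)"
  shows "regfun X U (\<lambda>x. F (f x) (f' x))"
  unfolding regfun_def
proof
  fix x
  assume "x \<in> U"
  then obtain V d g h where V: "zopen X V" "x \<in> V" "V \<subseteq> U" "hpoly d g" "hpoly d h"
      "\<forall>y\<in>V. \<forall>z\<in>y. h z \<noteq> 0 \<and> f y = g z / h z"
    using assms(1) unfolding regfun_def by meson
  obtain V' d' g' h' where V': "zopen X V'" "x \<in> V'" "V' \<subseteq> U" "hpoly d' g'" "hpoly d' h'"
      "\<forall>y\<in>V'. \<forall>z\<in>y. h' z \<noteq> 0 \<and> f' y = g' z / h' z"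
    using assms(2) \<open>x \<in> U\<close> unfolding regfun_def by meson
  obtain e k l where kl: "hpoly e k" "hpoly e l"
      "\<forall>z. h z \<noteq> 0 \<and> h' z \<noteq> 0 \<longrightarrow> l z \<noteq> 0 \<and> F (g z / h z) (g' z / h' z) = k z / l z"
    using assms(3)[OF V(4,5) V'(4,5)] by blast
  have "\<forall>y\<in>V \<inter> V'. \<forall>z\<in>y. l z \<noteq> 0 \<and> F (f y) (f' y) = k z / l z"
    using V(6) V'(6) kl(3) by (metis IntD1 IntD2)
  then show "\<exists>V. zopen X V \<and> x \<in> V \<and> V \<subseteq> U \<and> (\<exists>d g h. hpoly d g \<and> hpoly d h \<and>
      (\<forall>y\<in>V. \<forall>z\<in>y. h z \<noteq> 0 \<and> F (f y) (f' y) = g z / h z))"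
    using V V' kl(1,2) by (intro exI[of _ "V \<inter> V'"] conjI zopen_Int) blast+
qed

lemma regfun_add:
  assumes "regfun X U f" "regfun X U g"
  shows "regfun X U (\<lambda>x. f x + g x)"
proof (rule regfun_binop[OF assms])
  fix d d' and g h g' h' :: "complex^'k \<Rightarrow> complex"
  assume *: "hpoly d g" "hpoly d h" "hpoly d' g'" "hpoly d' h'"
  \<comment> \<open>\<open>hpoly_add\<close> requires the same degree term for both summands, so the
    degree \<open>d' + d\<close> of the second product is rewritten as
    \<open>d + d'\<close>.\<close>
  have "hpoly (d + d') (\<lambda>z. g z * h' z + g' z * h z)"
    by (intro hpoly_add hpoly_mult * hpoly_mult[of d' g' d h, unfolded add.commute[of d' d]])
  moreover have "hpoly (d + d') (\<lambda>z. h z * h' z)"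
    by (intro hpoly_mult *)
  ultimately show "\<exists>e k l. hpoly e k \<and> hpoly e l \<and>
        (\<forall>z. h z \<noteq> 0 \<and> h' z \<noteq> 0 \<longrightarrow> l z \<noteq> 0 \<and> g z / h z + g' z / h' z = k z / l z)"
    by - (rule exI, rule exI, rule exI, intro conjI, assumption, assumption, simp add: field_simps)
qed

lemma regfun_mult:
  assumes "regfun X U f" "regfun X U g"
  shows "regfun X U (\<lambda>x. f x * g x)"
proof (rule regfun_binop[OF assms])
  fix d d' and g h g' h' :: "complex^'k \<Rightarrow> complex"
  assume *: "hpoly d g" "hpoly d h" "hpoly d' g'" "hpoly d' h'"
  show "\<exists>e k l. hpoly e k \<and> hpoly e l \<and>
        (\<forall>z. h z \<noteq> 0 \<and> h' z \<noteq> 0 \<longrightarrow> l z \<noteq> 0 \<and> g z / h z * (g' z / h' z) = k z / l z)"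
    by (rule exI[of _ "d + d'"], rule exI[of _ "\<lambda>z. g z * g' z"], rule exI[of _ "\<lambda>z. h z * h' z"])
      (auto intro!: hpoly_add hpoly_mult * simp: field_simps)
qed

lemma regfun_sum:
  assumes "zopen X U" "\<And>i. i \<in> I \<Longrightarrow> regfun X U (f i)"
  shows "regfun X U (\<lambda>x. \<Sum>i\<in>I. f i x)"
  using assms(2)
  by (induction I rule: infinite_finite_induct) (auto intro: regfun_const assms(1) regfun_add)

text \<open>Near \<open>x\<close> the function is a quotient \<open>g / h\<close>, and
  \<open>g\<close> vanishes on the nonempty open set \<open>V \<inter> V'\<close>. So
  \<open>X\<close> is covered by the zero set of \<open>g\<close> and the complement of that open
  set, and irreducibility leaves only the former.\<close>

lemma regfun_identity:
  assumes "regfun X U f" "zopen X V" "V \<noteq> {}" "\<And>x. x \<in> U \<Longrightarrow> x \<in> V \<Longrightarrow> f x = 0" "x \<in> U"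
  shows "f x = 0"
proof -
  obtain V' d g h where V': "zopen X V'" "x \<in> V'" "V' \<subseteq> U" "hpoly d g"
      "\<forall>y\<in>V'. \<forall>z\<in>y. h z \<noteq> 0 \<and> f y = g z / h z"
    using assms(1,5) unfolding regfun_def by meson
  define Z where "Z = {P \<in> proj_space. \<forall>z\<in>P. g z = 0}"
  have "zopen X (V \<inter> V')" and ne: "V \<inter> V' \<noteq> {}"
    using zopen_Int zopen_Int_nonempty assms(2,3) V'(1,2) by blast+
  then obtain C where C: "zclosed C" "V \<inter> V' = X - C"
    unfolding zopen_def by blast
  have "P \<in> Z" if "P \<in> V \<inter> V'" for P
  proof -
    have "f P = 0"
      using that V'(3) assms(4) by blast
    then have "\<forall>z\<in>P. g z = 0"
      using that V'(5) by (metis IntD2 divide_eq_0_iff)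
    moreover have "P \<in> proj_space"
      using that V'(1) zopen_subset subset_proj_space by blast
    ultimately show ?thesis
      unfolding Z_def by blast
  qed
  then have "X \<subseteq> Z \<union> C"
    using C(2) by blast
  then have "X \<subseteq> Z"
    using irreducible C ne zclosed_zeros[OF V'(4)] unfolding zirreducible_def Z_def by blast
  then have "\<forall>z\<in>x. g z = 0" "x \<in> proj_space"
    using V'(1,2) zopen_subset unfolding Z_def by blast+
  then show ?thesis
    using V'(2,5) proj_space_nonempty by fastforce
qed

end

section \<open>Bundles with regular local frames\<close>

definition of_coords :: "('x, 'v) vbundle \<Rightarrow> 'x \<Rightarrow> ('v \<Rightarrow> nat \<Rightarrow> complex) \<Rightarrow>
    (nat \<Rightarrow> complex) \<Rightarrow> 'v" where
  "of_coords V x \<psi> c = inv_into (fib V x) \<psi> c"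

lemma unit_coord_in_coords: "j < n \<Longrightarrow> unit_coord j \<in> coords n"
  unfolding unit_coord_def coords_def by auto

lemma (in projective_variety) regsec_cong:
  assumes "regsec X V U s" "\<And>x. x \<in> U \<Longrightarrow> s x = t x"
  shows "regsec X V U t"
  unfolding regsec_def
proof (intro conjI ballI, goal_cases)
  case (1 x)
  then show ?case
    using assms unfolding regsec_def by metis
next
  case (2 T)
  then obtain U1 \<phi> where T: "T = (U1, \<phi>)" "\<forall>i<rk V. regfun X (U \<inter> U1) (\<lambda>x. \<phi> x (s x) i)"
    using assms(1) unfolding regsec_def by blast
  have "regfun X (U \<inter> U1) (\<lambda>x. \<phi> x (t x) i)" if "i < rk V" for i
    by (rule regfun_cong[OF T(2)[rule_format, OF that]]) (simp add: assms(2))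
  then show ?case
    unfolding T(1) by simp
qed

text \<open>The regularity of the frames given by the trivialisations replaces that of the transition
  functions in \<^const>\<open>vector_bundle\<close>; unlike the latter, it passes to \<^const>\<open>hom_bundle\<close>
  without any matrix computation.\<close>

locale framed_bundle = projective_variety X for X :: "(complex^'k) set set" +
  fixes V :: "((complex^'k) set, 'v::ab_group_add) vbundle"
  assumes vector_space: "vector_space (smul V)"
    and fib_subspace: "x \<in> X \<Longrightarrow> module.subspace (smul V) (fib V x)"
    and triv_open: "(U, \<phi>) \<in> triv V \<Longrightarrow> zopen X U"
    and triv_iso: "(U, \<phi>) \<in> triv V \<Longrightarrow> x \<in> U \<Longrightarrow> fibre_iso V x (\<phi> x)"
    and triv_frame: "(U, \<phi>) \<in> triv V \<Longrightarrow> j < rk V \<Longrightarrow>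
          regsec X V U (\<lambda>x. of_coords V x (\<phi> x) (unit_coord j))"
    and triv_cover: "x \<in> X \<Longrightarrow> \<exists>U \<phi>. (U, \<phi>) \<in> triv V \<and> x \<in> U"
begin

lemma module: "module (smul V)"
  using vector_space by (rule module_iff_vector_space[THEN iffD2])

lemmas zero_smul = module.scale_zero_left[OF module]
  and smul_minus_one = module.scale_minus_left[OF module, of 1, unfolded module.scale_one[OF module]]

lemma fib_zero: "x \<in> X \<Longrightarrow> 0 \<in> fib V x"
  using fib_subspace module.subspace_0[OF module] by blast

lemma fib_add: "x \<in> X \<Longrightarrow> u \<in> fib V x \<Longrightarrow> v \<in> fib V x \<Longrightarrow> u + v \<in> fib V x"
  using fib_subspace module.subspace_add[OF module] by blast

lemma fib_diff: "x \<in> X \<Longrightarrow> u \<in> fib V x \<Longrightarrow> v \<in> fib V x \<Longrightarrow> u - v \<in> fib V x"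
  using fib_subspace module.subspace_diff[OF module] by blast

lemma fib_smul: "x \<in> X \<Longrightarrow> u \<in> fib V x \<Longrightarrow> smul V c u \<in> fib V x"
  using fib_subspace module.subspace_scale[OF module] by blast

lemma fib_sum: "x \<in> X \<Longrightarrow> (\<And>i. i \<in> I \<Longrightarrow> f i \<in> fib V x) \<Longrightarrow> (\<Sum>i\<in>I. f i) \<in> fib V x"
  using fib_subspace module.subspace_sum[OF module] by blast

section \<open>Coordinates on a single fibre\<close>

context
  fixes x and \<psi> :: "'v \<Rightarrow> nat \<Rightarrow> complex"
  assumes x: "x \<in> X" and iso: "fibre_iso V x (\<psi>)"
begin

lemma coord_add: "u \<in> fib V x \<Longrightarrow> v \<in> fib V x \<Longrightarrow> \<psi> (u + v) i = \<psi> u i + \<psi> v i"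
  using iso unfolding fibre_iso_def by blast

lemma coord_smul: "v \<in> fib V x \<Longrightarrow> \<psi> (smul V c v) i = c * \<psi> v i"
  using iso unfolding fibre_iso_def by blast

lemma coord_zero: "\<psi> 0 i = 0"
  using coord_smul[OF fib_zero[OF x], of 0 i] by (simp add: zero_smul)

lemma coord_sum: "(\<And>j. j \<in> J \<Longrightarrow> f j \<in> fib V x) \<Longrightarrow> \<psi> (\<Sum>j\<in>J. f j) i = (\<Sum>j\<in>J. \<psi> (f j) i)"
  by (induction J rule: infinite_finite_induct) (simp_all add: coord_zero coord_add fib_sum x)

lemma coord_in_coords: "v \<in> fib V x \<Longrightarrow> \<psi> v \<in> coords (rk V)"
  using iso unfolding fibre_iso_def by (blast dest: bij_betwE)

lemma coord_inj: "u \<in> fib V x \<Longrightarrow> v \<in> fib V x \<Longrightarrow> \<psi> u = \<psi> v \<Longrightarrow> u = v"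
  using iso unfolding fibre_iso_def bij_betw_def inj_on_def by blast

lemma coord_ext:
  assumes "u \<in> fib V x" "v \<in> fib V x" "\<And>i. i < rk V \<Longrightarrow> \<psi> u i = \<psi> v i"
  shows "u = v"
proof (rule coord_inj[OF assms(1,2)], rule ext)
  fix i
  show "\<psi> u i = \<psi> v i"
    using coord_in_coords assms unfolding coords_def by (cases "i < rk V") auto
qed

lemma of_coords_in_fib: "c \<in> coords (rk V) \<Longrightarrow> of_coords V x \<psi> c \<in> fib V x"
  using iso unfolding fibre_iso_def bij_betw_def of_coords_def by (metis inv_into_into)

lemma coord_of_coords: "c \<in> coords (rk V) \<Longrightarrow> \<psi> (of_coords V x \<psi> c) = c"
  using iso unfolding fibre_iso_def bij_betw_def of_coords_def by (metis f_inv_into_f)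

lemma of_coords_coord: "v \<in> fib V x \<Longrightarrow> of_coords V x \<psi> (\<psi> v) = v"
  using coord_inj coord_of_coords of_coords_in_fib coord_in_coords by blast

lemma of_coords_expansion:
  assumes c: "c \<in> coords (rk V)"
  shows "of_coords V x \<psi> c = (\<Sum>j<rk V. smul V (c j) (of_coords V x \<psi> (unit_coord j)))"
proof (rule coord_ext)
  fix i
  assume i: "i < rk V"
  have "\<psi> (\<Sum>j<rk V. smul V (c j) (of_coords V x \<psi> (unit_coord j))) i
      = (\<Sum>j<rk V. c j * unit_coord j i)"
    by (subst coord_sum)
      (simp_all add: coord_smul coord_of_coords of_coords_in_fib fib_smul x unit_coord_in_coords)
  also have "\<dots> = (\<Sum>j<rk V. if j = i then c j else 0)"
    unfolding unit_coord_def by (rule sum.cong) auto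
  also have "\<dots> = c i"
    using i by simp
  finally show "\<psi> (of_coords V x \<psi> c) i
      = \<psi> (\<Sum>j<rk V. smul V (c j) (of_coords V x \<psi> (unit_coord j))) i"
    using coord_of_coords[OF c] by simp
qed (auto intro!: c of_coords_in_fib fib_sum fib_smul x unit_coord_in_coords)

lemma coord_expansion:
  "v \<in> fib V x \<Longrightarrow> v = (\<Sum>j<rk V. smul V (\<psi> v j) (of_coords V x \<psi> (unit_coord j)))"
  using of_coords_expansion of_coords_coord coord_in_coords by metis

end

lemma regsec_fib: "regsec X V U s \<Longrightarrow> x \<in> U \<Longrightarrow> s x \<in> fib V x"
  unfolding regsec_def by blast

lemma regsec_coord:
  assumes "regsec X V U s" "(U1, \<phi>) \<in> triv V" "i < rk V" "zopen X U'" "U' \<subseteq> U \<inter> U1"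
  shows "regfun X U' (\<lambda>x. \<phi> x (s x) i)"
proof -
  have "regfun X (U \<inter> U1) (\<lambda>x. \<phi> x (s x) i)"
    using assms(1-3) unfolding regsec_def by blast
  then show ?thesis
    using regfun_restrict assms(4,5) by blast
qed

lemma regsecI:
  assumes "\<And>x. x \<in> U \<Longrightarrow> s x \<in> fib V x"
    and "\<And>U1 \<phi> i. (U1, \<phi>) \<in> triv V \<Longrightarrow> i < rk V \<Longrightarrow> regfun X (U \<inter> U1) (\<lambda>x. \<phi> x (s x) i)"
  shows "regsec X V U s"
  using assms unfolding regsec_def by blast

lemma regsec_restrict:
  assumes "regsec X V U s" "zopen X U'" "U' \<subseteq> U"
  shows "regsec X V U' s"
proof (rule regsecI)
  fix U1 \<phi> i
  assume T: "(U1, \<phi>) \<in> triv V" "i < rk V"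
  show "regfun X (U' \<inter> U1) (\<lambda>x. \<phi> x (s x) i)"
    using assms by (intro regsec_coord[OF assms(1) T] zopen_Int triv_open[OF T(1)]) auto
qed (use assms regsec_fib in blast)

lemma regsec_local:
  assumes "\<And>x. x \<in> U \<Longrightarrow> \<exists>U'. zopen X U' \<and> x \<in> U' \<and> U' \<subseteq> U \<and> regsec X V U' s"
  shows "regsec X V U s"
proof (rule regsecI)
  fix U1 \<phi> i
  assume T: "(U1, \<phi>) \<in> triv V" "i < rk V"
  show "regfun X (U \<inter> U1) (\<lambda>x. \<phi> x (s x) i)"
  proof (rule regfun_local)
    fix x
    assume "x \<in> U \<inter> U1"
    then obtain U' where U': "zopen X U'" "x \<in> U'" "U' \<subseteq> U" "regsec X V U' s"
      using assms by blast
    have "regfun X (U' \<inter> U1) (\<lambda>x. \<phi> x (s x) i)"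
      by (intro regsec_coord[OF U'(4) T] zopen_Int U'(1) triv_open[OF T(1)]) auto
    then show "\<exists>V. x \<in> V \<and> V \<subseteq> U \<inter> U1 \<and> regfun X V (\<lambda>x. \<phi> x (s x) i)"
      using U' \<open>x \<in> U \<inter> U1\<close> by (intro exI[of _ "U' \<inter> U1"]) auto
  qed
qed (use assms regsec_fib in blast)

lemma regsec_zero:
  assumes U: "zopen X U"
  shows "regsec X V U (\<lambda>_. 0)"
proof (rule regsecI)
  fix U1 \<phi> i
  assume T: "(U1, \<phi>) \<in> triv V"
  show "regfun X (U \<inter> U1) (\<lambda>x. \<phi> x 0 i)"
    by (rule regfun_cong[OF regfun_const[OF zopen_Int[OF U triv_open[OF T]], of 0]])
      (use U zopen_subset coord_zero[OF _ triv_iso[OF T]] in auto)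
qed (use U zopen_subset fib_zero in blast)

lemma regsec_add:
  assumes U: "zopen X U" and s: "regsec X V U s" and t: "regsec X V U t"
  shows "regsec X V U (\<lambda>x. s x + t x)"
proof (rule regsecI)
  fix U1 \<phi> i
  assume T: "(U1, \<phi>) \<in> triv V" "i < rk V"
  have U1: "zopen X (U \<inter> U1)"
    by (intro zopen_Int U triv_open[OF T(1)])
  show "regfun X (U \<inter> U1) (\<lambda>x. \<phi> x (s x + t x) i)"
    by (rule regfun_cong[OF regfun_add[OF regsec_coord[OF s T U1] regsec_coord[OF t T U1]]])
      (use s t T U zopen_subset regsec_fib in \<open>auto intro!: coord_add[OF _ triv_iso[OF T(1)], symmetric]\<close>)
qed (use s t U zopen_subset fib_add regsec_fib in blast)

lemma regsec_smul:
  assumes U: "zopen X U" and h: "regfun X U h" and s: "regsec X V U s"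
  shows "regsec X V U (\<lambda>x. smul V (h x) (s x))"
proof (rule regsecI)
  fix U1 \<phi> i
  assume T: "(U1, \<phi>) \<in> triv V" "i < rk V"
  have U1: "zopen X (U \<inter> U1)"
    by (intro zopen_Int U triv_open[OF T(1)])
  show "regfun X (U \<inter> U1) (\<lambda>x. \<phi> x (smul V (h x) (s x)) i)"
    by (rule regfun_cong[OF regfun_mult[OF regfun_restrict[OF h U1] regsec_coord[OF s T U1]]])
      (use s T U zopen_subset regsec_fib in \<open>auto intro!: coord_smul[OF _ triv_iso[OF T(1)], symmetric]\<close>)
qed (use s U zopen_subset fib_smul regsec_fib in blast)

lemma regsec_diff:
  assumes U: "zopen X U" and s: "regsec X V U s" and t: "regsec X V U t"
  shows "regsec X V U (\<lambda>x. s x - t x)"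
  using regsec_add[OF U s regsec_smul[OF U regfun_const[OF U, of "- 1"] t]]
  by (simp add: smul_minus_one)

lemma regsec_sum:
  assumes "zopen X U" "\<And>i. i \<in> I \<Longrightarrow> regsec X V U (f i)"
  shows "regsec X V U (\<lambda>x. \<Sum>i\<in>I. f i x)"
  using assms(2)
  by (induction I rule: infinite_finite_induct) (auto intro: regsec_zero assms(1) regsec_add)

text \<open>The expansion in the frame of the chart has regular coefficients and regular frame
  vectors. This is the standard way below to build a regular section from regular
  coordinates.\<close>

lemma regsec_of_coords:
  assumes T: "(U1, \<phi>) \<in> triv V" and U: "zopen X U" "U \<subseteq> U1"
    and c: "\<And>x. x \<in> U \<Longrightarrow> c x \<in> coords (rk V)" "\<And>i. i < rk V \<Longrightarrow> regfun X U (\<lambda>x. c x i)"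
  shows "regsec X V U (\<lambda>x. of_coords V x (\<phi> x) (c x))"
proof (rule regsec_cong)
  show "regsec X V U (\<lambda>x. \<Sum>j<rk V. smul V (c x j) (of_coords V x (\<phi> x) (unit_coord j)))"
    using U by (intro regsec_sum regsec_smul c(2)) (auto intro: regsec_restrict[OF triv_frame[OF T]])
next
  fix x
  assume "x \<in> U"
  then show "(\<Sum>j<rk V. smul V (c x j) (of_coords V x (\<phi> x) (unit_coord j))) = of_coords V x (\<phi> x) (c x)"
    using U zopen_subset T c(1) by (intro of_coords_expansion[symmetric] triv_iso[OF T]) auto
qed

text \<open>In a chart at \<open>x\<close>, each difference of coordinates is a regular function
  vanishing on \<open>U'\<close>, so \<open>regfun_identity\<close> applies.\<close>

lemma regsec_identity:
  assumes U: "zopen X U" and s: "regsec X V U s" and t: "regsec X V U t"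
    and U': "zopen X U'" "U' \<noteq> {}" "\<And>x. x \<in> U \<Longrightarrow> x \<in> U' \<Longrightarrow> s x = t x" and x: "x \<in> U"
  shows "s x = t x"
proof -
  have "x \<in> X"
    using U x zopen_subset by blast
  then obtain U1 \<phi> where T: "(U1, \<phi>) \<in> triv V" "x \<in> U1"
    using triv_cover by blast
  have U1: "zopen X (U \<inter> U1)"
    by (intro zopen_Int U triv_open[OF T(1)])
  show ?thesis
  proof (rule coord_ext[OF \<open>x \<in> X\<close> triv_iso[OF T]])
    fix i
    assume i: "i < rk V"
    have "regfun X (U \<inter> U1) (\<lambda>x. \<phi> x (s x) i + (- 1) * \<phi> x (t x) i)"
      using regsec_coord[OF s T(1) i U1] regsec_coord[OF t T(1) i U1]
      by (intro regfun_add regfun_mult regfun_const U1) auto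
    then have "\<phi> x (s x) i + (- 1) * \<phi> x (t x) i = 0"
      by (rule regfun_identity[OF _ U'(1,2)]) (use U'(3) x T(2) in auto)
    then show "\<phi> x (s x) i = \<phi> x (t x) i"
      by simp
  qed (use s t x regsec_fib in auto)
qed

text \<open>The coordinates of \<open>v\<close> in a chart at \<open>x\<close> are kept constant
  along the chart.\<close>

lemma regsec_through_point:
  assumes "x \<in> X" "v \<in> fib V x"
  obtains U s where "zopen X U" "x \<in> U" "regsec X V U s" "s x = v"
proof -
  obtain U \<phi> where T: "(U, \<phi>) \<in> triv V" "x \<in> U"
    using assms(1) triv_cover by blast
  have U: "zopen X U"
    by (rule triv_open[OF T(1)])
  show thesis
  proof (rule that[OF U T(2)])
    show "regsec X V U (\<lambda>y. of_coords V y (\<phi> y) (\<phi> x v))"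
      by (rule regsec_of_coords[OF T(1) U])
        (auto intro: coord_in_coords assms triv_iso T regfun_const U)
    show "of_coords V x (\<phi> x) (\<phi> x v) = v"
      by (rule of_coords_coord[OF assms(1) triv_iso[OF T] assms(2)])
  qed
qed

end

text \<open>In a chart of the atlas the coordinates are combinations of the transition functions
  with constant coefficients. The chart (\<open>U\<close>, \<open>\<phi>\<close>) may be any one
  compatible with the atlas, because those adapted to a subbundle need not belong to
  \<open>triv V\<close>. Regularity of transition functions is converted into regularity of frames
  here.\<close>

lemma (in projective_variety) regsec_of_const_coords:
  assumes V: "vector_bundle X V" and T: "local_trivialisation X V (U, \<phi>)" and c: "c \<in> coords (rk V)"
  shows "regsec X V U (\<lambda>x. of_coords V x (\<phi> x) c)"
  unfolding regsec_def
proof (intro conjI ballI allI impI, goal_cases)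
  case (1 x)
  then show ?case
    using T c unfolding local_trivialisation_def fibre_iso_def bij_betw_def of_coords_def
    by (metis fst_conv inv_into_into snd_conv)
next
  case (2 T')
  obtain U' \<phi>' where T': "T' = (U', \<phi>')"
    by (cases T')
  have "\<exists>g. (\<forall>i<rk V. \<forall>j<rk V. regfun X (U \<inter> U') (g i j)) \<and>
     (\<forall>x\<in>U \<inter> U'. \<forall>v\<in>fib V x. \<forall>i<rk V. \<phi>' x v i = (\<Sum>j<rk V. g i j x * \<phi> x v j))"
    using T 2 unfolding local_trivialisation_def regular_transition_def T' by auto
  then obtain g where g: "\<And>i j. i < rk V \<Longrightarrow> j < rk V \<Longrightarrow> regfun X (U \<inter> U') (g i j)"
    "\<And>x v i. x \<in> U \<inter> U' \<Longrightarrow> v \<in> fib V x \<Longrightarrow> i < rk V \<Longrightarrow> \<phi>' x v i = (\<Sum>j<rk V. g i j x * \<phi> x v j)"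
    by blast
  have UU': "zopen X (U \<inter> U')"
    using V T 2 unfolding vector_bundle_def local_trivialisation_def T'
    by (metis fst_conv zopen_Int)
  have fib: "of_coords V x (\<phi> x) c \<in> fib V x" "\<phi> x (of_coords V x (\<phi> x) c) = c" if "x \<in> U" for x
    using that T c unfolding local_trivialisation_def fibre_iso_def bij_betw_def of_coords_def
    by (metis fst_conv inv_into_into snd_conv, metis fst_conv f_inv_into_f snd_conv)
  have "regfun X (U \<inter> U') (\<lambda>x. \<phi>' x (of_coords V x (\<phi> x) c) i)" if i: "i < rk V" for i
  proof (rule regfun_cong)
    show "regfun X (U \<inter> U') (\<lambda>x. \<Sum>j<rk V. g i j x * c j)"
      using i by (intro regfun_sum regfun_mult regfun_const UU' g(1)) auto
  qed (use i fib in \<open>auto simp: g(2)\<close>)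
  then show ?case
    unfolding T' by blast
qed

lemma (in projective_variety) framed_bundle:
  assumes V: "vector_bundle X V"
  shows "framed_bundle X V"
proof (intro framed_bundle.intro projective_variety_axioms framed_bundle_axioms.intro)
  fix U \<phi> j
  assume "(U, \<phi>) \<in> triv V" "j < rk V"
  then show "regsec X V U (\<lambda>x. of_coords V x (\<phi> x) (unit_coord j))"
    using V unfolding vector_bundle_def
    by (intro regsec_of_const_coords[OF assms] unit_coord_in_coords) auto
qed (use V in \<open>fastforce simp: vector_bundle_def local_trivialisation_def\<close>)+

section \<open>Homomorphism bundles\<close>

text \<open>The chart of \<open>hom_bundle\<close> on one fibre, as \<open>triv_hom_bundle\<close>
  records, separated from the atlas so that it makes sense for arbitrary coordinates
  \<open>\<phi>\<close> and \<open>\<psi>\<close>.\<close>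

definition hom_coords :: "('x, 'v) vbundle \<Rightarrow> ('x, 'w) vbundle \<Rightarrow> 'x \<Rightarrow> ('v \<Rightarrow> nat \<Rightarrow> complex) \<Rightarrow>
    ('w \<Rightarrow> nat \<Rightarrow> complex) \<Rightarrow> ('v \<Rightarrow> 'w) \<Rightarrow> nat \<Rightarrow> complex" where
  "hom_coords V V' x \<phi> \<psi> f k = (if k < rk V' * rk V
     then \<psi> (f (of_coords V x \<phi> (unit_coord (k mod rk V)))) (k div rk V) else 0)"

text \<open>The linear map with matrix \<open>c\<close>, an explicit inverse of
  \<open>hom_coords\<close> (see \<open>of_coords_hom\<close>). The value 0 off the fibre is the
  convention that \<open>hom_bundle\<close> imposes on its elements.\<close>

definition hom_of_coords :: "('x, 'v) vbundle \<Rightarrow> ('x, 'w::zero) vbundle \<Rightarrow> 'x \<Rightarrow>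
    ('v \<Rightarrow> nat \<Rightarrow> complex) \<Rightarrow> ('w \<Rightarrow> nat \<Rightarrow> complex) \<Rightarrow> (nat \<Rightarrow> complex) \<Rightarrow> 'v \<Rightarrow> 'w" where
  "hom_of_coords V V' x \<phi> \<psi> c = (\<lambda>v. if v \<in> fib V x
     then of_coords V' x \<psi> (\<lambda>i. if i < rk V' then \<Sum>j<rk V. \<phi> v j * c (i * rk V + j) else 0)
     else 0)"

lemma matrix_index_less:
  fixes i j m n :: nat
  assumes "i < m" "j < n"
  shows "i * n + j < m * n"
proof -
  have "i * n + j < Suc i * n"
    using assms by simp
  also have "\<dots> \<le> m * n"
    using assms by (intro mult_le_mono1) simp
  finally show ?thesis .
qed

lemma rk_hom_bundle: "rk (hom_bundle V V') = rk V' * rk V"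
  and smul_hom_bundle: "smul (hom_bundle V V') = (\<lambda>c f v. smul V' c (f v))"
  and fib_hom_bundle: "fib (hom_bundle V V') x = {f. (\<forall>v\<in>fib V x. f v \<in> fib V' x) \<and>
        (\<forall>u\<in>fib V x. \<forall>v\<in>fib V x. f (u + v) = f u + f v) \<and>
        (\<forall>c. \<forall>v\<in>fib V x. f (smul V c v) = smul V' c (f v)) \<and>
        (\<forall>v. v \<notin> fib V x \<longrightarrow> f v = 0)}"
  unfolding hom_bundle_def by simp_all

lemma triv_hom_bundle: "triv (hom_bundle V V') =
    {(U \<inter> U', \<lambda>x. hom_coords V V' x (\<phi> x) (\<psi> x)) | U \<phi> U' \<psi>. (U, \<phi>) \<in> triv V \<and> (U', \<psi>) \<in> triv V'}"
  unfolding hom_bundle_def hom_coords_def of_coords_def by simp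

locale bundle_pair = V: framed_bundle X V + V': framed_bundle X V'
  for X :: "(complex^'k) set set"
    and V :: "((complex^'k) set, 'v::ab_group_add) vbundle"
    and V' :: "((complex^'k) set, 'w::ab_group_add) vbundle"
begin

section \<open>Linear maps between fibres\<close>

context
  fixes f x
  assumes f: "f \<in> fib (hom_bundle V V') x" and x: "x \<in> X"
begin

lemma hom_in_fib: "v \<in> fib V x \<Longrightarrow> f v \<in> fib V' x"
  using f unfolding fib_hom_bundle by blast

lemma hom_add: "u \<in> fib V x \<Longrightarrow> v \<in> fib V x \<Longrightarrow> f (u + v) = f u + f v"
  using f unfolding fib_hom_bundle by blast

lemma hom_smul: "v \<in> fib V x \<Longrightarrow> f (smul V c v) = smul V' c (f v)"
  using f unfolding fib_hom_bundle by blast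

lemma hom_outside: "v \<notin> fib V x \<Longrightarrow> f v = 0"
  using f unfolding fib_hom_bundle by blast

lemma hom_zero: "f 0 = 0"
  using hom_smul[OF V.fib_zero[OF x], of 0] by (simp add: V.zero_smul V'.zero_smul)

lemma hom_diff: "u \<in> fib V x \<Longrightarrow> v \<in> fib V x \<Longrightarrow> f (u - v) = f u - f v"
  using hom_add[OF V.fib_diff[OF x, of u v], of v] by (simp add: algebra_simps)

lemma hom_sum: "(\<And>j. j \<in> J \<Longrightarrow> g j \<in> fib V x) \<Longrightarrow> f (\<Sum>j\<in>J. g j) = (\<Sum>j\<in>J. f (g j))"
  by (induction J rule: infinite_finite_induct) (simp_all add: hom_zero hom_add V.fib_sum x)

lemma hom_expansion:
  assumes "fibre_iso V x \<phi>" "v \<in> fib V x"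
  shows "f v = (\<Sum>j<rk V. smul V' (\<phi> v j) (f (of_coords V x \<phi> (unit_coord j))))"
proof -
  have e: "of_coords V x \<phi> (unit_coord j) \<in> fib V x" if "j < rk V" for j
    using that by (intro V.of_coords_in_fib x assms unit_coord_in_coords)
  have "f v = f (\<Sum>j<rk V. smul V (\<phi> v j) (of_coords V x \<phi> (unit_coord j)))"
    using V.coord_expansion[OF x assms] by simp
  also have "\<dots> = (\<Sum>j<rk V. smul V' (\<phi> v j) (f (of_coords V x \<phi> (unit_coord j))))"
    by (subst hom_sum) (auto intro!: V.fib_smul x e hom_smul sum.cong)
  finally show ?thesis .
qed

end

section \<open>Matrix coordinates on a fibre of the Hom bundle\<close>

context
  fixes x \<phi> \<psi>
  assumes x: "x \<in> X" and iso: "fibre_iso V x \<phi>" and iso': "fibre_iso V' x \<psi>"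
begin

lemma matrix_row_in_coords:
  "(\<lambda>i. if i < rk V' then \<Sum>j<rk V. \<phi> v j * c (i * rk V + j) else 0) \<in> coords (rk V')"
  unfolding coords_def by simp

lemma hom_of_coords_in_fib: "hom_of_coords V V' x \<phi> \<psi> c \<in> fib (hom_bundle V V') x"
  unfolding fib_hom_bundle hom_of_coords_def
proof (intro CollectI conjI ballI allI impI, goal_cases)
  case (1 v)
  then show ?case
    by (simp add: V'.of_coords_in_fib x iso' matrix_row_in_coords)
next
  case (2 u v)
  show ?case
  proof (rule V'.coord_ext[OF x iso'])
    fix i
    assume "i < rk V'"
    then show "\<psi> (if u + v \<in> fib V x then of_coords V' x \<psi>
            (\<lambda>i. if i < rk V' then \<Sum>j<rk V. \<phi> (u + v) j * c (i * rk V + j) else 0) else 0) i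
        = \<psi> ((if u \<in> fib V x then of_coords V' x \<psi>
            (\<lambda>i. if i < rk V' then \<Sum>j<rk V. \<phi> u j * c (i * rk V + j) else 0) else 0)
          + (if v \<in> fib V x then of_coords V' x \<psi>
            (\<lambda>i. if i < rk V' then \<Sum>j<rk V. \<phi> v j * c (i * rk V + j) else 0) else 0)) i"
      using 2 by (simp add: V.fib_add V'.coord_add[OF x iso'] V'.of_coords_in_fib V'.coord_of_coords
          x iso' matrix_row_in_coords V.coord_add[OF x iso] distrib_right sum.distrib)
  qed (use 2 in \<open>simp_all add: V.fib_add V'.fib_add V'.of_coords_in_fib x iso' matrix_row_in_coords\<close>)
next
  case (3 a v)
  show ?case
  proof (rule V'.coord_ext[OF x iso'])
    fix i
    assume "i < rk V'"
    then show "\<psi> (if smul V a v \<in> fib V x then of_coords V' x \<psi>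
            (\<lambda>i. if i < rk V' then \<Sum>j<rk V. \<phi> (smul V a v) j * c (i * rk V + j) else 0) else 0) i
        = \<psi> (smul V' a (if v \<in> fib V x then of_coords V' x \<psi>
            (\<lambda>i. if i < rk V' then \<Sum>j<rk V. \<phi> v j * c (i * rk V + j) else 0) else 0)) i"
      using 3 by (simp add: V.fib_smul V'.coord_smul[OF x iso'] V'.of_coords_in_fib V'.coord_of_coords
          x iso' matrix_row_in_coords V.coord_smul[OF x iso] sum_distrib_left mult.assoc)
  qed (use 3 in \<open>simp_all add: V.fib_smul V'.fib_smul V'.of_coords_in_fib x iso' matrix_row_in_coords\<close>)
qed simp

lemma hom_coords_hom_of_coords:
  assumes c: "c \<in> coords (rk V' * rk V)"
  shows "hom_coords V V' x \<phi> \<psi> (hom_of_coords V V' x \<phi> \<psi> c) = c"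
proof
  fix k
  show "hom_coords V V' x \<phi> \<psi> (hom_of_coords V V' x \<phi> \<psi> c) k = c k"
  proof (cases "k < rk V' * rk V")
    case True
    then have "rk V > 0"
      by (cases "rk V = 0") auto
    then have j: "k mod rk V < rk V" and i: "k div rk V < rk V'"
      using True by (auto simp: less_mult_imp_div_less)
    note u = unit_coord_in_coords[OF j]
    have "hom_coords V V' x \<phi> \<psi> (hom_of_coords V V' x \<phi> \<psi> c) k
        = (\<Sum>j<rk V. unit_coord (k mod rk V) j * c (k div rk V * rk V + j))"
      using True i u unfolding hom_coords_def hom_of_coords_def
      by (simp add: V.of_coords_in_fib V.coord_of_coords V'.coord_of_coords x iso iso' matrix_row_in_coords)
    also have "\<dots> = (\<Sum>j<rk V. if j = k mod rk V then c (k div rk V * rk V + j) else 0)"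
      unfolding unit_coord_def by (rule sum.cong) auto
    also have "\<dots> = c k"
      using j by simp
    finally show ?thesis .
  next
    case False
    then show ?thesis
      using c unfolding hom_coords_def coords_def by auto
  qed
qed

text \<open>Column \<open>j\<close> of the matrix lists the coordinates of the image of the
  \<open>j\<close>-th frame vector, so the two maps agree on a frame of the fibre; off the fibre
  both are zero.\<close>

lemma hom_coords_inj:
  assumes f: "f \<in> fib (hom_bundle V V') x" and g: "g \<in> fib (hom_bundle V V') x"
    and eq: "hom_coords V V' x \<phi> \<psi> f = hom_coords V V' x \<phi> \<psi> g"
  shows "f = g"
proof
  fix v
  have e: "f (of_coords V x \<phi> (unit_coord j)) = g (of_coords V x \<phi> (unit_coord j))"
    if j: "j < rk V" for j
  proof (rule V'.coord_ext[OF x iso'])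
    have "of_coords V x \<phi> (unit_coord j) \<in> fib V x"
      by (intro V.of_coords_in_fib x iso unit_coord_in_coords j)
    then show "f (of_coords V x \<phi> (unit_coord j)) \<in> fib V' x"
      "g (of_coords V x \<phi> (unit_coord j)) \<in> fib V' x"
      using hom_in_fib[OF f x] hom_in_fib[OF g x] by auto
    fix i
    assume i: "i < rk V'"
    have k: "i * rk V + j < rk V' * rk V"
    by (rule matrix_index_less[OF i j])
    show "\<psi> (f (of_coords V x \<phi> (unit_coord j))) i = \<psi> (g (of_coords V x \<phi> (unit_coord j))) i"
      using fun_cong[OF eq, of "i * rk V + j"] k j by (simp add: hom_coords_def)
  qed
  show "f v = g v"
  proof (cases "v \<in> fib V x")
    case True
    then show ?thesis
      using hom_expansion[OF f x iso True] hom_expansion[OF g x iso True] e by simp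
  next
    case False
    then show ?thesis
      using hom_outside[OF f x] hom_outside[OF g x] by simp
  qed
qed

lemma fibre_iso_hom: "fibre_iso (hom_bundle V V') x (hom_coords V V' x \<phi> \<psi>)"
  unfolding fibre_iso_def
proof (intro conjI ballI allI)
  show "bij_betw (hom_coords V V' x \<phi> \<psi>) (fib (hom_bundle V V') x) (coords (rk (hom_bundle V V')))"
    unfolding bij_betw_def
  proof (intro conjI inj_onI set_eqI iffI)
    fix c
    assume "c \<in> coords (rk (hom_bundle V V'))"
    then show "c \<in> hom_coords V V' x \<phi> \<psi> ` fib (hom_bundle V V') x"
      using hom_coords_hom_of_coords hom_of_coords_in_fib unfolding rk_hom_bundle by (metis image_eqI)
  qed (auto simp: hom_coords_inj hom_coords_def coords_def rk_hom_bundle)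
next
  have e: "of_coords V x \<phi> (unit_coord (k mod rk V)) \<in> fib V x" if "k < rk V' * rk V" for k
  proof (intro V.of_coords_in_fib x iso unit_coord_in_coords)
    show "k mod rk V < rk V"
      using that by (cases "rk V = 0") auto
  qed
  fix u v i
  assume u: "u \<in> fib (hom_bundle V V') x"
  show "hom_coords V V' x \<phi> \<psi> (smul (hom_bundle V V') c u) i = c * hom_coords V V' x \<phi> \<psi> u i" for c
    using e u by (auto simp: hom_coords_def smul_hom_bundle V'.coord_smul[OF x iso'] hom_in_fib x)
  assume v: "v \<in> fib (hom_bundle V V') x"
  show "hom_coords V V' x \<phi> \<psi> (u + v) i = hom_coords V V' x \<phi> \<psi> u i + hom_coords V V' x \<phi> \<psi> v i"
    using e u v by (auto simp: hom_coords_def V'.coord_add[OF x iso'] hom_in_fib x)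
qed

lemma of_coords_hom:
  assumes "c \<in> coords (rk V' * rk V)"
  shows "of_coords (hom_bundle V V') x (hom_coords V V' x \<phi> \<psi>) c = hom_of_coords V V' x \<phi> \<psi> c"
  using fibre_iso_hom hom_of_coords_in_fib hom_coords_hom_of_coords[OF assms]
  unfolding fibre_iso_def bij_betw_def of_coords_def by (metis inv_into_f_f)

end

section \<open>Regular sections of the Hom bundle\<close>

lemma regsec_hom_frame:
  assumes s: "regsec X (hom_bundle V V') U s" and T: "(U1, \<phi>) \<in> triv V" and j: "j < rk V"
    and U: "zopen X U"
  shows "regsec X V' (U \<inter> U1) (\<lambda>x. s x (of_coords V x (\<phi> x) (unit_coord j)))"
proof (rule V'.regsecI)
  fix x
  assume x: "x \<in> U \<inter> U1"
  then have "x \<in> X"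
    using V.zopen_subset U by blast
  then show "s x (of_coords V x (\<phi> x) (unit_coord j)) \<in> fib V' x"
    using s x j unfolding regsec_def
    by (intro hom_in_fib V.of_coords_in_fib unit_coord_in_coords V.triv_iso[OF T]) auto
next
  fix U2 \<psi> i
  assume T': "(U2, \<psi>) \<in> triv V'" and i: "i < rk V'"
  have k: "i * rk V + j < rk V' * rk V"
    by (rule matrix_index_less[OF i j])
  have "(U1 \<inter> U2, \<lambda>x. hom_coords V V' x (\<phi> x) (\<psi> x)) \<in> triv (hom_bundle V V')"
    using T T' unfolding triv_hom_bundle by blast
  then have "regfun X (U \<inter> (U1 \<inter> U2)) (\<lambda>x. hom_coords V V' x (\<phi> x) (\<psi> x) (s x) (i * rk V + j))"
    using conjunct2[OF s[unfolded regsec_def]] k unfolding rk_hom_bundle by fastforce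
  then show "regfun X (U \<inter> U1 \<inter> U2) (\<lambda>x. \<psi> x (s x (of_coords V x (\<phi> x) (unit_coord j))) i)"
    using k j by (simp add: hom_coords_def Int_assoc)
qed

text \<open>Converse of \<open>regsec_hom_frame\<close>: the coordinates of \<open>s\<close> in a
  chart of \<open>hom_bundle\<close> are the coordinates in \<open>V'\<close> of the images of frame
  vectors. Regularity of a homomorphism can thus be tested on frames.\<close>

lemma regsec_homI:
  assumes fib: "\<And>x. x \<in> U \<Longrightarrow> s x \<in> fib (hom_bundle V V') x"
    and frame: "\<And>U1 \<phi> j. (U1, \<phi>) \<in> triv V \<Longrightarrow> j < rk V \<Longrightarrow>
      regsec X V' (U \<inter> U1) (\<lambda>x. s x (of_coords V x (\<phi> x) (unit_coord j)))"
  shows "regsec X (hom_bundle V V') U s"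
  unfolding regsec_def
proof (intro conjI ballI, goal_cases)
  case (2 T)
  then obtain U1 \<phi> U2 \<psi> where T: "(U1, \<phi>) \<in> triv V" "(U2, \<psi>) \<in> triv V'"
      "T = (U1 \<inter> U2, \<lambda>x. hom_coords V V' x (\<phi> x) (\<psi> x))"
    unfolding triv_hom_bundle by blast
  have "regfun X (U \<inter> (U1 \<inter> U2)) (\<lambda>x. hom_coords V V' x (\<phi> x) (\<psi> x) (s x) k)"
    if k: "k < rk V' * rk V" for k
  proof -
    have "k mod rk V < rk V" "k div rk V < rk V'"
      using k by (cases "rk V = 0"; auto simp: less_mult_imp_div_less)+
    then have "regfun X (U \<inter> U1 \<inter> U2)
        (\<lambda>x. \<psi> x (s x (of_coords V x (\<phi> x) (unit_coord (k mod rk V)))) (k div rk V))"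
      using frame[OF T(1)] T(2) unfolding regsec_def by blast
    then show ?thesis
      using k by (simp add: hom_coords_def Int_assoc)
  qed
  then show ?case
    unfolding T(3) rk_hom_bundle by simp
qed (rule fib)

text \<open>Near each point \<open>v\<close> is a combination of frame vectors with regular
  coefficients, and linearity of \<open>s x\<close> reduces the claim to
  \<open>regsec_hom_frame\<close>.\<close>

lemma regsec_hom_app:
  assumes U: "zopen X U" and s: "regsec X (hom_bundle V V') U s" and v: "regsec X V U v"
  shows "regsec X V' U (\<lambda>x. s x (v x))"
proof (rule V'.regsec_local)
  fix x
  assume x: "x \<in> U"
  then obtain U1 \<phi> where T: "(U1, \<phi>) \<in> triv V" "x \<in> U1"
    using V.triv_cover V.zopen_subset U by blast
  have U1: "zopen X (U \<inter> U1)"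
    by (intro V.zopen_Int U V.triv_open[OF T(1)])
  have "regsec X V' (U \<inter> U1)
      (\<lambda>y. \<Sum>j<rk V. smul V' (\<phi> y (v y) j) (s y (of_coords V y (\<phi> y) (unit_coord j))))"
    using V.regsec_coord[OF v T(1) _ U1] regsec_hom_frame[OF s T(1) _ U]
    by (intro V'.regsec_sum V'.regsec_smul U1) auto
  then have "regsec X V' (U \<inter> U1) (\<lambda>x. s x (v x))"
  proof (rule V.regsec_cong)
    fix y
    assume y: "y \<in> U \<inter> U1"
    then have "y \<in> X"
      using V.zopen_subset U by blast
    then show "(\<Sum>j<rk V. smul V' (\<phi> y (v y) j) (s y (of_coords V y (\<phi> y) (unit_coord j)))) = s y (v y)"
      using y s V.regsec_fib[OF v] V.triv_iso[OF T(1)] unfolding regsec_def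
      by (intro hom_expansion[symmetric]) auto
  qed
  then show "\<exists>U'. zopen X U' \<and> x \<in> U' \<and> U' \<subseteq> U \<and> regsec X V' U' (\<lambda>x. s x (v x))"
    using U1 x T(2) by blast
qed

text \<open>The matrix is constant in the charts \<open>\<phi>\<close> and \<open>\<psi>\<close>,
  but regularity has to be tested on the frame of an arbitrary chart \<open>\<phi>1\<close>. By
  \<open>triv_frame\<close> that frame has regular coordinates in \<open>\<phi>\<close>, and so does
  its image in \<open>\<psi>\<close>.\<close>

lemma regsec_hom_of_coords:
  assumes T: "(U, \<phi>) \<in> triv V" and T': "(U', \<psi>) \<in> triv V'"
  shows "regsec X (hom_bundle V V') (U \<inter> U') (\<lambda>x. hom_of_coords V V' x (\<phi> x) (\<psi> x) c)"
proof (rule regsec_homI)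
  fix x
  assume x: "x \<in> U \<inter> U'"
  then have "x \<in> X"
    using V.zopen_subset V.triv_open[OF T] by blast
  then show "hom_of_coords V V' x (\<phi> x) (\<psi> x) c \<in> fib (hom_bundle V V') x"
    using x by (intro hom_of_coords_in_fib V.triv_iso[OF T] V'.triv_iso[OF T']) auto
next
  fix U1 \<phi>1 j
  assume T1: "(U1, \<phi>1) \<in> triv V" and j: "j < rk V"
  define e where "e = (\<lambda>x. of_coords V x (\<phi>1 x) (unit_coord j))"
  define c' where "c' = (\<lambda>x i. if i < rk V' then \<Sum>k<rk V. \<phi> x (e x) k * c (i * rk V + k) else 0)"
  have W: "zopen X (U \<inter> U' \<inter> U1)"
    by (intro V.zopen_Int V.triv_open[OF T] V.triv_open[OF T1] V'.triv_open[OF T'])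
  have "regsec X V U1 e"
    unfolding e_def by (rule V.triv_frame[OF T1 j])
  then have "regfun X (U \<inter> U' \<inter> U1) (\<lambda>x. \<phi> x (e x) k)" if "k < rk V" for k
    using that W by (intro V.regsec_coord[OF _ T]) auto
  then have "regfun X (U \<inter> U' \<inter> U1) (\<lambda>x. c' x i)" if "i < rk V'" for i
    using that unfolding c'_def by (auto intro!: V.regfun_sum V.regfun_mult V.regfun_const W)
  then have "regsec X V' (U \<inter> U' \<inter> U1) (\<lambda>x. of_coords V' x (\<psi> x) (c' x))"
    by (intro V'.regsec_of_coords[OF T'] W) (auto simp: c'_def coords_def)
  then show "regsec X V' (U \<inter> U' \<inter> U1)
      (\<lambda>x. hom_of_coords V V' x (\<phi> x) (\<psi> x) c (of_coords V x (\<phi>1 x) (unit_coord j)))"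
  proof (rule V.regsec_cong)
    fix x
    assume "x \<in> U \<inter> U' \<inter> U1"
    then have "e x \<in> fib V x"
      using V.regsec_fib[OF \<open>regsec X V U1 e\<close>] by blast
    then show "of_coords V' x (\<psi> x) (c' x)
        = hom_of_coords V V' x (\<phi> x) (\<psi> x) c (of_coords V x (\<phi>1 x) (unit_coord j))"
      unfolding e_def c'_def hom_of_coords_def by simp
  qed
qed

text \<open>Closure of framed bundles under Hom: through the sublocale declarations that rest on it,
  every result on framed bundles becomes available for Hom(E, L) and then for Hom(Hom(E, L),
  E).\<close>

lemma framed_hom_bundle: "framed_bundle X (hom_bundle V V')"
proof (intro framed_bundle.intro V.projective_variety_axioms framed_bundle_axioms.intro)
  interpret V': vector_space "smul V'"
    by (rule V'.vector_space)
  show vs: "vector_space (smul (hom_bundle V V'))"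
    unfolding smul_hom_bundle
    by unfold_locales
      (simp_all add: fun_eq_iff V'.scale_right_distrib V'.scale_left_distrib)
  fix x
  assume x: "x \<in> X"
  show "module.subspace (smul (hom_bundle V V')) (fib (hom_bundle V V') x)"
    by (rule module.subspaceI[OF vs[unfolded module_iff_vector_space[symmetric]]])
      (auto simp: fib_hom_bundle smul_hom_bundle V'.fib_zero V'.fib_add V'.fib_smul x
        V'.scale_right_distrib V'.scale_left_commute)
  obtain U \<phi> U' \<psi> where "(U, \<phi>) \<in> triv V" "x \<in> U" "(U', \<psi>) \<in> triv V'" "x \<in> U'"
    using x V.triv_cover V'.triv_cover by metis
  then show "\<exists>U \<phi>. (U, \<phi>) \<in> triv (hom_bundle V V') \<and> x \<in> U"
    unfolding triv_hom_bundle by blast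
next
  fix U \<phi> x
  assume T: "(U, \<phi>) \<in> triv (hom_bundle V V')"
  then show "zopen X U"
    unfolding triv_hom_bundle using V.triv_open V'.triv_open V.zopen_Int by auto
  then have x: "x \<in> X" if "x \<in> U" for x
    using that V.zopen_subset by blast
  obtain U1 \<phi>1 U2 \<phi>2 where T12: "(U1, \<phi>1) \<in> triv V" "(U2, \<phi>2) \<in> triv V'"
      "U = U1 \<inter> U2" "\<phi> = (\<lambda>x. hom_coords V V' x (\<phi>1 x) (\<phi>2 x))"
    using T unfolding triv_hom_bundle by blast
  show "fibre_iso (hom_bundle V V') x (\<phi> x)" if "x \<in> U"
    using that x unfolding T12(3,4)
    by (intro fibre_iso_hom V.triv_iso[OF T12(1)] V'.triv_iso[OF T12(2)]) auto
  fix j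
  assume j: "j < rk (hom_bundle V V')"
  have c: "unit_coord j \<in> coords (rk V' * rk V)"
    using j unfolding rk_hom_bundle by (rule unit_coord_in_coords)
  show "regsec X (hom_bundle V V') U (\<lambda>x. of_coords (hom_bundle V V') x (\<phi> x) (unit_coord j))"
    unfolding T12(3)
  proof (rule V.regsec_cong[OF regsec_hom_of_coords[OF T12(1,2), of "unit_coord j"]])
    fix x
    assume "x \<in> U1 \<inter> U2"
    then show "hom_of_coords V V' x (\<phi>1 x) (\<phi>2 x) (unit_coord j)
        = of_coords (hom_bundle V V') x (\<phi> x) (unit_coord j)"
      using x unfolding T12(3,4)
      by (intro of_coords_hom[symmetric] V.triv_iso[OF T12(1)] V'.triv_iso[OF T12(2)] c) auto
  qed
qed

end

section \<open>Germs at the generic point\<close>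

context projective_variety
begin

text \<open>Stated for arbitrary functions rather than for members of \<open>ratrep\<close>, so that
  pointwise operations respect it without regularity side conditions.\<close>

definition gen_eq :: "((complex^'k) set \<Rightarrow> 'v) \<Rightarrow> ((complex^'k) set \<Rightarrow> 'v) \<Rightarrow> bool" where
  "gen_eq s t \<longleftrightarrow> (\<exists>U. zopen X U \<and> U \<noteq> {} \<and> (\<forall>x\<in>U. s x = t x))"

lemma gen_eqI: "zopen X U \<Longrightarrow> U \<noteq> {} \<Longrightarrow> (\<And>x. x \<in> U \<Longrightarrow> s x = t x) \<Longrightarrow> gen_eq s t"
  unfolding gen_eq_def by blast

lemma gen_eq_refl: "gen_eq s s"
  using zopen_self nonempty by (auto intro: gen_eqI)

lemma gen_eq_sym: "gen_eq s t \<Longrightarrow> gen_eq t s"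
  unfolding gen_eq_def by metis

lemma gen_eq_map2:
  assumes "gen_eq s s'" "gen_eq t t'"
  shows "gen_eq (\<lambda>x. h x (s x) (t x)) (\<lambda>x. h x (s' x) (t' x))"
proof -
  obtain U U' where "zopen X U" "U \<noteq> {}" "\<forall>x\<in>U. s x = s' x"
    "zopen X U'" "U' \<noteq> {}" "\<forall>x\<in>U'. t x = t' x"
    using assms unfolding gen_eq_def by blast
  then show ?thesis
    by (intro gen_eqI[of "U \<inter> U'"] zopen_Int zopen_Int_nonempty) auto
qed

lemma gen_eq_trans:
  assumes "gen_eq s t" "gen_eq t r"
  shows "gen_eq s r"
proof -
  obtain U U' where "zopen X U" "U \<noteq> {}" "\<forall>x\<in>U. s x = t x"
    "zopen X U'" "U' \<noteq> {}" "\<forall>x\<in>U'. t x = r x"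
    using assms unfolding gen_eq_def by blast
  then show ?thesis
    by (intro gen_eqI[of "U \<inter> U'"] zopen_Int zopen_Int_nonempty) auto
qed

lemma rclass_gen_eq: "rclass X V s = {t \<in> ratrep X V. gen_eq s t}"
  unfolding rclass_def gen_eq_def by simp

lemma rclass_cong: "gen_eq s t \<Longrightarrow> rclass X V s = rclass X V t"
  unfolding rclass_gen_eq using gen_eq_sym gen_eq_trans by blast

lemma rclass_self: "s \<in> ratrep X V \<Longrightarrow> s \<in> rclass X V s"
  unfolding rclass_gen_eq using gen_eq_refl by blast

text \<open>Rationality of \<open>t\<close> puts \<open>t\<close> into the common class. Without it
  both classes could be empty, and their equality would say nothing.\<close>

lemma rclass_eqD: "rclass X V s = rclass X V t \<Longrightarrow> t \<in> ratrep X V \<Longrightarrow> gen_eq s t"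
  using rclass_self[of t V] unfolding rclass_gen_eq by blast

lemma rclass_in_Rat: "s \<in> ratrep X V \<Longrightarrow> rclass X V s \<in> Rat X V"
  unfolding Rat_def by blast

lemma RatE:
  assumes "A \<in> Rat X V"
  obtains s where "s \<in> ratrep X V" "A = rclass X V s"
  using assms unfolding Rat_def by blast

lemma ratrepI: "zopen X U \<Longrightarrow> U \<noteq> {} \<Longrightarrow> regsec X V U s \<Longrightarrow> s \<in> ratrep X V"
  unfolding ratrep_def by blast

text \<open>A pointwise operation preserves generic equality, so all members of the union in
  \<open>rmap\<close> coincide; \<open>rclass_self\<close> makes the index set nonempty, so the
  union is that common value.\<close>

lemma rmap_rclass:
  assumes "s \<in> ratrep X V"
  shows "rmap X V' h (rclass X V s) = rclass X V' (\<lambda>x. h x (s x))"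
proof -
  have "rclass X V' (\<lambda>x. h x (t x)) = rclass X V' (\<lambda>x. h x (s x))" if "t \<in> rclass X V s" for t
  proof -
    have "gen_eq t s"
      using that gen_eq_sym unfolding rclass_gen_eq by blast
    from gen_eq_map2[OF this this, of "\<lambda>x u v. h x u"] show ?thesis
      by (rule rclass_cong)
  qed
  then have "rmap X V' h (rclass X V s) = (\<Union>t\<in>rclass X V s. rclass X V' (\<lambda>x. h x (s x)))"
    unfolding rmap_def by (rule SUP_cong[OF refl])
  then show ?thesis
    using rclass_self[OF assms] by auto
qed

lemma rmap2_rclass:
  assumes "s \<in> ratrep X V" "t \<in> ratrep X V'"
  shows "rmap2 X V'' h (rclass X V s) (rclass X V' t) = rclass X V'' (\<lambda>x. h x (s x) (t x))"
proof -
  have "rclass X V'' (\<lambda>x. h x (s' x) (t' x)) = rclass X V'' (\<lambda>x. h x (s x) (t x))"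
    if "s' \<in> rclass X V s" "t' \<in> rclass X V' t" for s' t'
  proof -
    have "gen_eq s' s" "gen_eq t' t"
      using that gen_eq_sym unfolding rclass_gen_eq by blast+
    then show ?thesis
      by (intro rclass_cong gen_eq_map2[of s' s t' t h])
  qed
  then have "rmap2 X V'' h (rclass X V s) (rclass X V' t) =
      (\<Union>s'\<in>rclass X V s. \<Union>t'\<in>rclass X V' t. rclass X V'' (\<lambda>x. h x (s x) (t x)))"
    unfolding rmap2_def by (intro SUP_cong refl)
  then show ?thesis
    using rclass_self[OF assms(1)] rclass_self[OF assms(2)] by auto
qed

end

context framed_bundle
begin

lemma gen_eq_regsec:
  assumes "zopen X U" "regsec X V U s" "regsec X V U t" "gen_eq s t" "x \<in> U"
  shows "s x = t x"
proof -
  obtain U' where U': "zopen X U'" "U' \<noteq> {}" "\<forall>x\<in>U'. s x = t x"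
    using assms(4) unfolding gen_eq_def by blast
  show ?thesis
    by (rule regsec_identity[OF assms(1-3) U'(1,2) _ assms(5)]) (use U'(3) in blast)
qed

lemma ratrep_diff:
  assumes "s \<in> ratrep X V" "t \<in> ratrep X V"
  shows "(\<lambda>x. s x - t x) \<in> ratrep X V"
proof -
  obtain U U' where *: "zopen X U" "U \<noteq> {}" "regsec X V U s" "zopen X U'" "U' \<noteq> {}" "regsec X V U' t"
    using assms unfolding ratrep_def by blast
  have "zopen X (U \<inter> U')"
    using * zopen_Int by blast
  then show ?thesis
    using * by (intro ratrepI[of "U \<inter> U'"] zopen_Int_nonempty regsec_diff)
      (auto intro: regsec_restrict[OF *(3)] regsec_restrict[OF *(6)])
qed

section \<open>Principal parts\<close>

text \<open>Membership of the class of \<open>s\<close> in the stalk at \<open>x\<close>, in terms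
  of representatives (see \<open>rclass_in_stalk\<close>). The function \<open>s\<close> itself may
  be badly behaved at \<open>x\<close>; only its germ at the generic point matters.\<close>

definition regular_at :: "(complex^'k) set \<Rightarrow> ((complex^'k) set \<Rightarrow> 'v) \<Rightarrow> bool" where
  "regular_at x s \<longleftrightarrow> (\<exists>U t. zopen X U \<and> x \<in> U \<and> regsec X V U t \<and> gen_eq s t)"

lemma regular_atI: "zopen X U \<Longrightarrow> x \<in> U \<Longrightarrow> regsec X V U s \<Longrightarrow> regular_at x s"
  unfolding regular_at_def using gen_eq_refl by blast

lemma regular_at_cong: "gen_eq s t \<Longrightarrow> regular_at x s \<Longrightarrow> regular_at x t"
  unfolding regular_at_def using gen_eq_sym gen_eq_trans by metis

lemma regular_at_diff:
  assumes "regular_at x s" "regular_at x t"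
  shows "regular_at x (\<lambda>y. s y - t y)"
proof -
  obtain U s' U' t' where *: "zopen X U" "x \<in> U" "regsec X V U s'" "gen_eq s s'"
    "zopen X U'" "x \<in> U'" "regsec X V U' t'" "gen_eq t t'"
    using assms unfolding regular_at_def by blast
  have U: "zopen X (U \<inter> U')"
    using * zopen_Int by blast
  have "regsec X V (U \<inter> U') (\<lambda>x. s' x - t' x)"
    by (intro regsec_diff U regsec_restrict[OF *(3)] regsec_restrict[OF *(7)]) auto
  then show ?thesis
    unfolding regular_at_def using U * gen_eq_map2[OF *(4,8), of "\<lambda>_. (-)"] by blast
qed

lemma regular_at_zero: "x \<in> X \<Longrightarrow> regular_at x (\<lambda>_. 0)"
  using zopen_self regsec_zero by (blast intro: regular_atI)

lemma regular_at_diff_sym: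
  assumes "x \<in> X" "regular_at x (\<lambda>y. s y - t y)"
  shows "regular_at x (\<lambda>y. t y - s y)"
  using regular_at_diff[OF regular_at_zero[OF assms(1)] assms(2)] by simp

lemma regular_at_diff_trans:
  assumes "x \<in> X" "regular_at x (\<lambda>y. s y - t y)" "regular_at x (\<lambda>y. t y - r y)"
  shows "regular_at x (\<lambda>y. s y - r y)"
  using regular_at_diff[OF assms(2) regular_at_diff_sym[OF assms(1,3)]] by simp

text \<open>The local regular representatives \<open>t x\<close> are all generically equal to
  \<open>s\<close>, hence agree on overlaps by the identity principle. They are glued along the
  diagonal: the value at \<open>y\<close> is taken from the representative chosen at
  \<open>y\<close>.\<close>

lemma regular_everywhere:
  assumes "\<And>x. x \<in> X \<Longrightarrow> regular_at x s"
  obtains t where "regsec X V X t" "gen_eq s t"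
proof -
  obtain U t where *: "\<And>x. x \<in> X \<Longrightarrow> zopen X (U x)" "\<And>x. x \<in> X \<Longrightarrow> x \<in> U x"
    "\<And>x. x \<in> X \<Longrightarrow> regsec X V (U x) (t x)" "\<And>x. x \<in> X \<Longrightarrow> gen_eq s (t x)"
    using assms unfolding regular_at_def by metis
  have eq: "t x y = t y y" if "x \<in> X" "y \<in> U x" for x y
  proof -
    have y: "y \<in> X"
      using that zopen_subset *(1) by blast
    have U: "zopen X (U x \<inter> U y)"
      using that y zopen_Int *(1) by blast
    show ?thesis
    proof (rule gen_eq_regsec[OF U, of "t x" "t y"])
      show "regsec X V (U x \<inter> U y) (t x)" "regsec X V (U x \<inter> U y) (t y)"
        using that y by (auto intro: regsec_restrict[OF *(3) U])
      show "gen_eq (t x) (t y)"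
        using that y by (intro gen_eq_trans[OF gen_eq_sym[OF *(4)] *(4)])
    qed (use that y *(2) in auto)
  qed
  have U: "regsec X V (U x) (\<lambda>y. t y y)" if "x \<in> X" for x
    by (rule regsec_cong[OF *(3)[OF that]]) (rule eq[OF that])
  show thesis
  proof (rule that)
    show "regsec X V X (\<lambda>y. t y y)"
    proof (rule regsec_local)
      fix x
      assume x: "x \<in> X"
      show "\<exists>U'. zopen X U' \<and> x \<in> U' \<and> U' \<subseteq> X \<and> regsec X V U' (\<lambda>y. t y y)"
        using U[OF x] *(1,2)[OF x] zopen_subset[OF *(1)[OF x]] by (intro exI[of _ "U x"]) simp
    qed
    obtain x where x: "x \<in> X"
      using nonempty by blast
    have "gen_eq (t x) (\<lambda>y. t y y)"
      by (rule gen_eqI[OF *(1)[OF x]]) (use *(2)[OF x] eq[OF x] in auto)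
    then show "gen_eq s (\<lambda>y. t y y)"
      using *(4)[OF x] gen_eq_trans by blast
  qed
qed

lemma rclass_in_stalk: "rclass X V s \<in> stalk X V x \<longleftrightarrow> regular_at x s"
proof
  assume "rclass X V s \<in> stalk X V x"
  then obtain U t where *: "zopen X U" "x \<in> U" "regsec X V U t" "rclass X V s = rclass X V t"
    unfolding stalk_def secs_def by blast
  then have "gen_eq s t"
    by (intro rclass_eqD[OF *(4)] ratrepI) auto
  then show "regular_at x s"
    unfolding regular_at_def using * by blast
next
  assume "regular_at x s"
  then show "rclass X V s \<in> stalk X V x"
    unfolding regular_at_def stalk_def secs_def using rclass_cong by blast
qed

lemma rdiff_rclass:
  "s \<in> ratrep X V \<Longrightarrow> t \<in> ratrep X V \<Longrightarrow>
    rdiff X V (rclass X V s) (rclass X V t) = rclass X V (\<lambda>x. s x - t x)"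
  unfolding rdiff_def by (rule rmap2_rclass)

lemma rclass_in_pgerm:
  "s \<in> ratrep X V \<Longrightarrow> t \<in> ratrep X V \<Longrightarrow>
    rclass X V t \<in> pgerm X V x (rclass X V s) \<longleftrightarrow> regular_at x (\<lambda>y. t y - s y)"
  unfolding pgerm_def by (simp add: rclass_in_Rat rdiff_rclass rclass_in_stalk)

lemma pgermE:
  assumes "A \<in> pgerm X V x (rclass X V s)" "s \<in> ratrep X V"
  obtains t where "t \<in> ratrep X V" "A = rclass X V t" "regular_at x (\<lambda>y. t y - s y)"
  using assms rclass_in_pgerm unfolding pgerm_def
  by (metis (no_types, lifting) RatE mem_Collect_eq)

lemma pgerm_self: "s \<in> ratrep X V \<Longrightarrow> x \<in> X \<Longrightarrow> rclass X V s \<in> pgerm X V x (rclass X V s)"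
  by (simp add: rclass_in_pgerm regular_at_zero)

text \<open>\<open>pgerm\<close> is a coset of the stalk inside \<open>Rat\<close>, so two of them
  coincide exactly when the representatives differ by an element of the stalk.\<close>

lemma pgerm_eq_iff:
  assumes s: "s \<in> ratrep X V" and t: "t \<in> ratrep X V" and x: "x \<in> X"
  shows "pgerm X V x (rclass X V s) = pgerm X V x (rclass X V t) \<longleftrightarrow> regular_at x (\<lambda>y. s y - t y)"
proof
  assume "pgerm X V x (rclass X V s) = pgerm X V x (rclass X V t)"
  then show "regular_at x (\<lambda>y. s y - t y)"
    using pgerm_self[OF s x] rclass_in_pgerm[OF t s] by simp
next
  have sub: "pgerm X V x (rclass X V s) \<subseteq> pgerm X V x (rclass X V t)"
    if st: "regular_at x (\<lambda>y. s y - t y)" "s \<in> ratrep X V" "t \<in> ratrep X V" for s t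
  proof
    fix A
    assume A: "A \<in> pgerm X V x (rclass X V s)"
    obtain r where "r \<in> ratrep X V" "A = rclass X V r" "regular_at x (\<lambda>y. r y - s y)"
      by (rule pgermE[OF A st(2)])
    then show "A \<in> pgerm X V x (rclass X V t)"
      using st regular_at_diff_trans[OF x] by (simp add: rclass_in_pgerm)
  qed
  assume "regular_at x (\<lambda>y. s y - t y)"
  then show "pgerm X V x (rclass X V s) = pgerm X V x (rclass X V t)"
    using sub s t regular_at_diff_sym[OF x] by blast
qed

text \<open>Other lifts of the two germs change the difference by an element of the stalk, so the
  union in \<open>pdiff\<close> ranges over equal cosets, and the given lifts show that it is not
  empty. The same pattern serves \<open>papp_pgerm\<close> and
  \<open>ptranspose_pgerm\<close>.\<close>

lemma pdiff_pgerm: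
  assumes s: "s \<in> ratrep X V" and t: "t \<in> ratrep X V" and x: "x \<in> X"
    and p: "p x = pgerm X V x (rclass X V s)" and q: "q x = pgerm X V x (rclass X V t)"
  shows "pdiff X V p q x = pgerm X V x (rclass X V (\<lambda>y. s y - t y))"
proof -
  have "pgerm X V x (rdiff X V A B) = pgerm X V x (rclass X V (\<lambda>y. s y - t y))"
    if A: "A \<in> p x" and B: "B \<in> q x" for A B
  proof -
    obtain s' where s': "s' \<in> ratrep X V" "A = rclass X V s'" "regular_at x (\<lambda>y. s' y - s y)"
      by (rule pgermE[OF A[unfolded p] s])
    obtain t' where t': "t' \<in> ratrep X V" "B = rclass X V t'" "regular_at x (\<lambda>y. t' y - t y)"
      by (rule pgermE[OF B[unfolded q] t])
    have "regular_at x (\<lambda>y. (s' y - t' y) - (s y - t y))"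
      using regular_at_diff[OF s'(3) t'(3)] by (simp add: algebra_simps)
    then show ?thesis
      unfolding s'(2) t'(2) rdiff_rclass[OF s'(1) t'(1)]
      using s t s' t' x by (simp add: pgerm_eq_iff ratrep_diff)
  qed
  moreover have "rclass X V s \<in> p x" "rclass X V t \<in> q x"
    unfolding p q using s t x by (auto intro: pgerm_self)
  ultimately show ?thesis
    unfolding pdiff_def using x by auto
qed

lemma PrinE:
  assumes "p \<in> Prin X V" "x \<in> X"
  obtains U s where "zopen X U" "x \<in> U" "s \<in> ratrep X V"
    "\<And>y. y \<in> U \<Longrightarrow> p y = pgerm X V y (rclass X V s)"
proof -
  obtain U A where *: "zopen X U" "x \<in> U" "A \<in> Rat X V" "\<forall>y\<in>U. p y = pgerm X V y A"
    using assms unfolding Prin_def by blast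
  obtain s where s: "s \<in> ratrep X V" "A = rclass X V s"
    by (rule RatE[OF *(3)])
  show thesis
    by (rule that[OF *(1,2) s(1)]) (use *(4) s(2) in blast)
qed

end

sublocale bundle_pair \<subseteq> hom: framed_bundle X "hom_bundle V V'"
  by (rule framed_hom_bundle)

context bundle_pair
begin

lemma ratrep_app:
  assumes "s \<in> ratrep X (hom_bundle V V')" "v \<in> ratrep X V"
  shows "(\<lambda>x. s x (v x)) \<in> ratrep X V'"
proof -
  obtain U U' where *: "zopen X U" "U \<noteq> {}" "regsec X (hom_bundle V V') U s"
      "zopen X U'" "U' \<noteq> {}" "regsec X V U' v"
    using assms unfolding ratrep_def by blast
  have "zopen X (U \<inter> U')"
    using * V.zopen_Int by blast
  then show ?thesis
    using * by (intro V.ratrepI[of "U \<inter> U'"] V.zopen_Int_nonempty regsec_hom_app)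
      (auto intro: hom.regsec_restrict[OF *(3)] V.regsec_restrict[OF *(6)])
qed

lemma rapp_rclass:
  "s \<in> ratrep X (hom_bundle V V') \<Longrightarrow> v \<in> ratrep X V \<Longrightarrow>
    rapp X V' (rclass X (hom_bundle V V') s) (rclass X V v) = rclass X V' (\<lambda>x. s x (v x))"
  unfolding rapp_def by (rule V.rmap2_rclass)

lemma regular_at_app:
  assumes "hom.regular_at x s" "V.regular_at x v"
  shows "V'.regular_at x (\<lambda>y. s y (v y))"
proof -
  obtain U s' U' v' where *: "zopen X U" "x \<in> U" "regsec X (hom_bundle V V') U s'" "V.gen_eq s s'"
    "zopen X U'" "x \<in> U'" "regsec X V U' v'" "V.gen_eq v v'"
    using assms unfolding V.regular_at_def hom.regular_at_def by blast
  have U: "zopen X (U \<inter> U')"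
    using * V.zopen_Int by blast
  have "regsec X V' (U \<inter> U') (\<lambda>x. s' x (v' x))"
    by (intro regsec_hom_app U hom.regsec_restrict[OF *(3)] V.regsec_restrict[OF *(7)]) auto
  then show ?thesis
    unfolding V'.regular_at_def using U * V.gen_eq_map2[OF *(4,8), of "\<lambda>_ f v. f v"] by blast
qed

text \<open>Replacing the lift \<open>s\<close> by \<open>t\<close> changes the value by (t - s)(v).
  Both factors must be regular at \<open>x\<close> for this to be regular, which is why
  \<open>v\<close> is assumed regular there.\<close>

lemma papp_pgerm:
  assumes s: "s \<in> ratrep X (hom_bundle V V')" and v: "v \<in> ratrep X V" and x: "x \<in> X"
    and p: "p x = pgerm X (hom_bundle V V') x (rclass X (hom_bundle V V') s)"
    and reg: "V.regular_at x v"
  shows "papp X V' p (rclass X V v) x = pgerm X V' x (rclass X V' (\<lambda>y. s y (v y)))"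
proof -
  have "pgerm X V' x (rapp X V' A (rclass X V v)) = pgerm X V' x (rclass X V' (\<lambda>y. s y (v y)))"
    if A: "A \<in> p x" for A
  proof -
    obtain t where t: "t \<in> ratrep X (hom_bundle V V')" "A = rclass X (hom_bundle V V') t"
        "hom.regular_at x (\<lambda>y. t y - s y)"
      by (rule hom.pgermE[OF A[unfolded p] s])
    have "V'.regular_at x (\<lambda>y. t y (v y) - s y (v y))"
      using regular_at_app[OF t(3) reg] by simp
    then show ?thesis
      unfolding t(2) rapp_rclass[OF t(1) v]
      using s t(1) v x by (simp add: V'.pgerm_eq_iff ratrep_app)
  qed
  moreover have "rclass X (hom_bundle V V') s \<in> p x"
    unfolding p using s x by (rule hom.pgerm_self)
  ultimately show ?thesis
    unfolding papp_def using x by auto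
qed

end

section \<open>The transpose\<close>

text \<open>For \<open>rk L = 1\<close> this is the \<open>j\<close>-th coordinate function of
  \<open>E\<close> times the frame vector of \<open>L\<close>: the only row of the matrix is the
  \<open>j\<close>-th unit vector.\<close>

definition dual_frame :: "('x, 'e) vbundle \<Rightarrow> ('x, 'l::zero) vbundle \<Rightarrow> 'x \<Rightarrow>
    ('e \<Rightarrow> nat \<Rightarrow> complex) \<Rightarrow> ('l \<Rightarrow> nat \<Rightarrow> complex) \<Rightarrow> nat \<Rightarrow> 'e \<Rightarrow> 'l" where
  "dual_frame E L x \<phi> \<psi> j = hom_of_coords E L x \<phi> \<psi> (unit_coord j)"

text \<open>Candidate for the transpose. Pairing with the \<open>j\<close>-th dual frame vector
  reads off the \<open>j\<close>-th coordinate, so the defining identity of the transpose forces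
  this value. Index 0 is the only coordinate of \<open>L\<close>.\<close>

definition coord_transpose :: "('x, 'e::ab_group_add) vbundle \<Rightarrow> ('x, 'l::ab_group_add) vbundle \<Rightarrow> 'x \<Rightarrow>
    ('e \<Rightarrow> nat \<Rightarrow> complex) \<Rightarrow> ('l \<Rightarrow> nat \<Rightarrow> complex) \<Rightarrow> (('e \<Rightarrow> 'l) \<Rightarrow> 'e) \<Rightarrow> ('e \<Rightarrow> 'l) \<Rightarrow> 'e" where
  "coord_transpose E L x \<phi> \<psi> \<gamma> f = (if f \<in> fib (hom_bundle E L) x
     then of_coords E x \<phi> (\<lambda>j. if j < rk E then \<psi> (f (\<gamma> (dual_frame E L x \<phi> \<psi> j))) 0 else 0)
     else 0)"

locale twisted_dual = projective_variety X + E: framed_bundle X E + L: framed_bundle X L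
  for X :: "(complex^'k) set set"
    and E :: "((complex^'k) set, 'e::ab_group_add) vbundle"
    and L :: "((complex^'k) set, 'l::ab_group_add) vbundle" +
  assumes rk_L: "rk L = 1"

sublocale twisted_dual \<subseteq> EL: bundle_pair X E L ..

sublocale twisted_dual \<subseteq> FE: bundle_pair X "hom_bundle E L" E ..

context twisted_dual
begin

abbreviation "F \<equiv> hom_bundle E L"
abbreviation "H \<equiv> hom_bundle F E"

context
  fixes x \<phi> \<psi>
  assumes x: "x \<in> X" and iso: "fibre_iso E x \<phi>" and iso': "fibre_iso L x \<psi>"
begin

lemma dual_frame_in_fib: "dual_frame E L x \<phi> \<psi> j \<in> fib F x"
  unfolding dual_frame_def by (intro EL.hom_of_coords_in_fib x iso iso')

lemma coord_dual_frame:
  assumes "v \<in> fib E x" "j < rk E"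
  shows "\<psi> (dual_frame E L x \<phi> \<psi> j v) 0 = \<phi> v j"
proof -
  have "\<psi> (dual_frame E L x \<phi> \<psi> j v) 0 = (\<Sum>k<rk E. \<phi> v k * unit_coord j k)"
    unfolding dual_frame_def hom_of_coords_def
    using assms EL.matrix_row_in_coords[OF x iso iso', of v "unit_coord j"]
    by (simp add: L.coord_of_coords[OF x iso'] rk_L)
  also have "\<dots> = (\<Sum>k<rk E. if k = j then \<phi> v k else 0)"
    unfolding unit_coord_def by (rule sum.cong) auto
  finally show ?thesis
    using assms by simp
qed

text \<open>The dual frame reads off all coordinates. This gives uniqueness of the transpose, and
  later turns the vanishing of all g(d(f)) into d = 0.\<close>

lemma dual_separates:
  assumes "u \<in> fib E x" "v \<in> fib E x" "\<And>f. f \<in> fib F x \<Longrightarrow> f u = f v"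
  shows "u = v"
  by (rule E.coord_ext[OF x iso assms(1,2)])
    (metis assms coord_dual_frame dual_frame_in_fib)

lemma hom_dual_expansion:
  assumes \<gamma>: "\<gamma> \<in> fib H x" and f: "f \<in> fib F x"
  shows "\<gamma> f = (\<Sum>j<rk E. smul E (\<psi> (f (of_coords E x \<phi> (unit_coord j))) 0)
           (\<gamma> (dual_frame E L x \<phi> \<psi> j)))"
proof -
  have "\<gamma> f = (\<Sum>j<rk F. smul E (hom_coords E L x \<phi> \<psi> f j)
          (\<gamma> (of_coords F x (hom_coords E L x \<phi> \<psi>) (unit_coord j))))"
    by (rule FE.hom_expansion[OF \<gamma> x EL.fibre_iso_hom[OF x iso iso'] f])
  also have "\<dots> = (\<Sum>j<rk E. smul E (\<psi> (f (of_coords E x \<phi> (unit_coord j))) 0)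
           (\<gamma> (dual_frame E L x \<phi> \<psi> j)))"
    \<comment> \<open>As \<open>rk L = 1\<close>, the matrix of \<open>f\<close> has a single row:
      index \<open>j\<close> stands for row 0 and column \<open>j\<close>.\<close>
    by (intro sum.cong)
      (auto simp: rk_hom_bundle rk_L hom_coords_def dual_frame_def
        EL.of_coords_hom[OF x iso iso'] unit_coord_in_coords)
  finally show ?thesis .
qed

lemma coord_coord_transpose:
  "f \<in> fib F x \<Longrightarrow> j < rk E \<Longrightarrow>
    \<phi> (coord_transpose E L x \<phi> \<psi> \<gamma> f) j = \<psi> (f (\<gamma> (dual_frame E L x \<phi> \<psi> j))) 0"
  unfolding coord_transpose_def by (simp add: E.coord_of_coords[OF x iso] coords_def)

lemma coord_transpose_in_fib_E: "f \<in> fib F x \<Longrightarrow> coord_transpose E L x \<phi> \<psi> \<gamma> f \<in> fib E x"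
  unfolding coord_transpose_def by (simp add: E.of_coords_in_fib[OF x iso] coords_def)

lemma coord_transpose_in_fib:
  assumes \<gamma>: "\<gamma> \<in> fib H x"
  shows "coord_transpose E L x \<phi> \<psi> \<gamma> \<in> fib H x"
  unfolding fib_hom_bundle[of F E]
proof (intro CollectI conjI ballI allI impI)
  have \<gamma>_dual: "\<gamma> (dual_frame E L x \<phi> \<psi> j) \<in> fib E x" for j
    by (rule FE.hom_in_fib[OF \<gamma> x dual_frame_in_fib])
  fix f
  assume f: "f \<in> fib F x"
  then show "coord_transpose E L x \<phi> \<psi> \<gamma> f \<in> fib E x"
    by (rule coord_transpose_in_fib_E)
  show "coord_transpose E L x \<phi> \<psi> \<gamma> (smul F c f) = smul E c (coord_transpose E L x \<phi> \<psi> \<gamma> f)" for c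
    using f EL.hom.fib_smul[OF x f, of c] EL.hom_in_fib[OF f x \<gamma>_dual]
    by (intro E.coord_ext[OF x iso])
      (simp_all add: coord_transpose_in_fib_E E.fib_smul[OF x] E.coord_smul[OF x iso]
        coord_coord_transpose, simp add: smul_hom_bundle L.coord_smul[OF x iso'])
  fix g
  assume g: "g \<in> fib F x"
  show "coord_transpose E L x \<phi> \<psi> \<gamma> (f + g)
      = coord_transpose E L x \<phi> \<psi> \<gamma> f + coord_transpose E L x \<phi> \<psi> \<gamma> g"
    using f g EL.hom.fib_add[OF x f g] EL.hom_in_fib[OF f x \<gamma>_dual] EL.hom_in_fib[OF g x \<gamma>_dual]
    by (intro E.coord_ext[OF x iso])
      (simp_all add: coord_transpose_in_fib_E E.fib_add[OF x] E.coord_add[OF x iso]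
        coord_coord_transpose, simp add: L.coord_add[OF x iso'])
qed (simp add: coord_transpose_def)

text \<open>Write e_j for the frame of \<open>E\<close> and d_j for the dual frame. Expanding the
  left side in the e_j, and \<open>\<gamma> f\<close> in the \<open>\<gamma>\<close>(d_j), makes
  both sides the sum over j of g(\<open>\<gamma>\<close>(d_j)) times f(e_j), read in the one
  coordinate of \<open>L\<close>.\<close>

lemma coord_transpose_app:
  assumes \<gamma>: "\<gamma> \<in> fib H x" and f: "f \<in> fib F x" and g: "g \<in> fib F x"
  shows "f (coord_transpose E L x \<phi> \<psi> \<gamma> g) = g (\<gamma> f)"
proof (rule L.coord_ext[OF x iso'])
  note t = coord_transpose_in_fib_E[OF g, of \<gamma>]
  note \<gamma>f = FE.hom_in_fib[OF \<gamma> x f]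
  show "f (coord_transpose E L x \<phi> \<psi> \<gamma> g) \<in> fib L x" "g (\<gamma> f) \<in> fib L x"
    by (rule EL.hom_in_fib[OF f x t], rule EL.hom_in_fib[OF g x \<gamma>f])
  have e: "f (of_coords E x \<phi> (unit_coord j)) \<in> fib L x" if "j < rk E" for j
    using that by (intro EL.hom_in_fib[OF f x] E.of_coords_in_fib[OF x iso] unit_coord_in_coords)
  have d: "\<gamma> (dual_frame E L x \<phi> \<psi> j) \<in> fib E x" for j
    by (rule FE.hom_in_fib[OF \<gamma> x dual_frame_in_fib])
  have "\<psi> (f (coord_transpose E L x \<phi> \<psi> \<gamma> g)) 0
      = (\<Sum>j<rk E. \<psi> (g (\<gamma> (dual_frame E L x \<phi> \<psi> j))) 0 * \<psi> (f (of_coords E x \<phi> (unit_coord j))) 0)"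
    unfolding EL.hom_expansion[OF f x iso t]
    by (subst L.coord_sum[OF x iso'])
      (auto intro!: sum.cong L.fib_smul[OF x] e simp: L.coord_smul[OF x iso'] e coord_coord_transpose[OF g])
  also have "\<dots> = \<psi> (\<Sum>j<rk E. smul L (\<psi> (f (of_coords E x \<phi> (unit_coord j))) 0)
      (g (\<gamma> (dual_frame E L x \<phi> \<psi> j)))) 0"
    by (subst L.coord_sum[OF x iso'])
      (auto intro!: sum.cong L.fib_smul[OF x] EL.hom_in_fib[OF g x d]
        simp: L.coord_smul[OF x iso'] EL.hom_in_fib[OF g x d])
  also have "(\<Sum>j<rk E. smul L (\<psi> (f (of_coords E x \<phi> (unit_coord j))) 0)
      (g (\<gamma> (dual_frame E L x \<phi> \<psi> j)))) = g (\<gamma> f)"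
    unfolding hom_dual_expansion[OF \<gamma> f]
    by (subst EL.hom_sum[OF g x]) (auto intro!: sum.cong E.fib_smul[OF x] d simp: EL.hom_smul[OF g x d])
  finally show "\<psi> (f (coord_transpose E L x \<phi> \<psi> \<gamma> g)) i = \<psi> (g (\<gamma> f)) i" if "i < rk L" for i
    using that by (simp add: rk_L)
qed

lemma transpose_unique:
  assumes \<delta>: "\<delta> \<in> fib H x" and \<delta>': "\<delta>' \<in> fib H x"
    and eq: "\<And>f g. f \<in> fib F x \<Longrightarrow> g \<in> fib F x \<Longrightarrow> f (\<delta> g) = f (\<delta>' g)"
  shows "\<delta> = \<delta>'"
proof
  fix g
  show "\<delta> g = \<delta>' g"
  proof (cases "g \<in> fib F x")
    case True
    then show ?thesis
      using eq FE.hom_in_fib[OF \<delta> x] FE.hom_in_fib[OF \<delta>' x] by (intro dual_separates) auto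
  next
    case False
    then show ?thesis
      using FE.hom_outside[OF \<delta> x] FE.hom_outside[OF \<delta>' x] by simp
  qed
qed

text \<open>Existence is \<open>coord_transpose_app\<close>, uniqueness is
  \<open>transpose_unique\<close>. The definite description is therefore meaningful on the fibre,
  and the formula does not depend on the coordinates chosen.\<close>

lemma fib_transpose_eq_coord_transpose:
  assumes \<gamma>: "\<gamma> \<in> fib H x"
  shows "fib_transpose E L x \<gamma> = coord_transpose E L x \<phi> \<psi> \<gamma>"
  unfolding fib_transpose_def
proof (rule the_equality)
  show *: "coord_transpose E L x \<phi> \<psi> \<gamma> \<in> fib H x \<and> (\<forall>f\<in>fib F x. \<forall>g\<in>fib F x.
      g (\<gamma> f) = f (coord_transpose E L x \<phi> \<psi> \<gamma> g))"
    by (simp add: coord_transpose_in_fib[OF \<gamma>] coord_transpose_app[OF \<gamma>])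
  fix \<delta>
  assume "\<delta> \<in> fib H x \<and> (\<forall>f\<in>fib F x. \<forall>g\<in>fib F x. g (\<gamma> f) = f (\<delta> g))"
  then show "\<delta> = coord_transpose E L x \<phi> \<psi> \<gamma>"
    using * by (intro transpose_unique) auto
qed

end

context
  fixes x
  assumes x: "x \<in> X"
begin

lemma fibre_isos:
  obtains \<phi> \<psi> where "fibre_iso E x \<phi>" "fibre_iso L x \<psi>"
  using x E.triv_cover E.triv_iso L.triv_cover L.triv_iso by metis

lemma fib_transpose_in_fib: "\<gamma> \<in> fib H x \<Longrightarrow> fib_transpose E L x \<gamma> \<in> fib H x"
  by (metis fibre_isos fib_transpose_eq_coord_transpose coord_transpose_in_fib x)

lemma fib_transpose_app:
  "\<gamma> \<in> fib H x \<Longrightarrow> f \<in> fib F x \<Longrightarrow> g \<in> fib F x \<Longrightarrow> f (fib_transpose E L x \<gamma> g) = g (\<gamma> f)"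
  by (metis fibre_isos fib_transpose_eq_coord_transpose coord_transpose_app x)

text \<open>Both sides satisfy the defining identity of the transpose of
  \<open>\<gamma> - \<delta>\<close>, so uniqueness applies.\<close>

lemma fib_transpose_diff:
  assumes \<gamma>: "\<gamma> \<in> fib H x" and \<delta>: "\<delta> \<in> fib H x"
  shows "fib_transpose E L x (\<gamma> - \<delta>) = fib_transpose E L x \<gamma> - fib_transpose E L x \<delta>"
proof -
  obtain \<phi> \<psi> where iso: "fibre_iso E x \<phi>" "fibre_iso L x \<psi>"
    by (rule fibre_isos)
  have d: "\<gamma> - \<delta> \<in> fib H x"
    by (rule FE.hom.fib_diff[OF x \<gamma> \<delta>])
  show ?thesis
  proof (rule transpose_unique[OF x iso])
    fix f g
    assume f: "f \<in> fib F x" and g: "g \<in> fib F x"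
    have "f (fib_transpose E L x (\<gamma> - \<delta>) g) = g (\<gamma> f) - g (\<delta> f)"
      unfolding fib_transpose_app[OF d f g]
      by (simp add: EL.hom_diff[OF g x] FE.hom_in_fib[OF _ x f] \<gamma> \<delta>)
    also have "\<dots> = f ((fib_transpose E L x \<gamma> - fib_transpose E L x \<delta>) g)"
      by (simp add: EL.hom_diff[OF f x] FE.hom_in_fib[OF fib_transpose_in_fib x g] \<gamma> \<delta>
          fib_transpose_app f g)
    finally show "f (fib_transpose E L x (\<gamma> - \<delta>) g)
        = f ((fib_transpose E L x \<gamma> - fib_transpose E L x \<delta>) g)" .
  qed (simp_all add: fib_transpose_in_fib FE.hom.fib_diff[OF x] \<gamma> \<delta>)
qed

end

text \<open>Tested on the frame of Hom(E, L) dual to a chart of \<open>E\<close>: the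
  \<open>j\<close>-th coordinate of the transpose applied to \<open>\<epsilon> k\<close> is the
  coordinate of \<open>\<epsilon> k\<close> evaluated at \<open>s\<close> of
  \<open>\<epsilon> j\<close>, an iterated application of regular sections.\<close>

lemma regsec_transpose:
  assumes U: "zopen X U" and s: "regsec X H U s"
  shows "regsec X H U (\<lambda>x. fib_transpose E L x (s x))"
proof (rule FE.regsec_homI)
  fix x
  assume "x \<in> U"
  then show "fib_transpose E L x (s x) \<in> fib H x"
    using U zopen_subset FE.hom.regsec_fib[OF s] by (intro fib_transpose_in_fib) auto
next
  fix U1 \<Phi> k
  assume T: "(U1, \<Phi>) \<in> triv F" and k: "k < rk F"
  obtain U2 \<phi> U3 \<psi> where *: "(U2, \<phi>) \<in> triv E" "(U3, \<psi>) \<in> triv L"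
    "U1 = U2 \<inter> U3" "\<Phi> = (\<lambda>x. hom_coords E L x (\<phi> x) (\<psi> x))"
    using T unfolding triv_hom_bundle by blast
  define N where "N = U \<inter> U1"
  define \<epsilon> where "\<epsilon> = (\<lambda>j x. dual_frame E L x (\<phi> x) (\<psi> x) j)"
  define c where "c = (\<lambda>x j. if j < rk E then \<psi> x (\<epsilon> k x (s x (\<epsilon> j x))) 0 else 0)"
  have N: "zopen X N" "N \<subseteq> U" "N \<subseteq> U2" "N \<subseteq> U3"
    unfolding N_def using zopen_Int[OF U EL.hom.triv_open[OF T]] *(3) by auto
  have U1: "zopen X U1"
    by (rule EL.hom.triv_open[OF T])
  have \<epsilon>: "regsec X F N (\<epsilon> j)" for j
    unfolding \<epsilon>_def dual_frame_def
    by (rule EL.hom.regsec_restrict[OF EL.regsec_hom_of_coords[OF *(1,2)] N(1)])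
      (use N in auto)
  have L: "regsec X L N (\<lambda>x. \<epsilon> k x (s x (\<epsilon> j x)))" for j
    by (intro EL.regsec_hom_app[OF N(1) \<epsilon>] FE.regsec_hom_app[OF N(1) _ \<epsilon>]
        FE.hom.regsec_restrict[OF s N(1,2)])
  have "regfun X N (\<lambda>x. c x j)" if "j < rk E" for j
    using that N(2,4) L.regsec_coord[OF L *(2) _ N(1), of 0 j] unfolding c_def by (simp add: rk_L)
  then have "regsec X E N (\<lambda>x. of_coords E x (\<phi> x) (c x))"
    by (intro E.regsec_of_coords[OF *(1) N(1,3)]) (auto simp: c_def coords_def)
  then have "regsec X E N (\<lambda>x. fib_transpose E L x (s x) (of_coords F x (\<Phi> x) (unit_coord k)))"
  proof (rule regsec_cong)
    fix x
    assume xN: "x \<in> N"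
    have x: "x \<in> X"
      using zopen_subset[OF N(1)] xN by blast
    have iso: "fibre_iso E x (\<phi> x)" "fibre_iso L x (\<psi> x)"
      using N xN by (auto intro: E.triv_iso[OF *(1)] L.triv_iso[OF *(2)])
    have "of_coords F x (\<Phi> x) (unit_coord k) = \<epsilon> k x"
      unfolding *(4) \<epsilon>_def dual_frame_def using k
      by (intro EL.of_coords_hom[OF x iso] unit_coord_in_coords) (simp add: rk_hom_bundle)
    then show "of_coords E x (\<phi> x) (c x)
        = fib_transpose E L x (s x) (of_coords F x (\<Phi> x) (unit_coord k))"
      using EL.hom.regsec_fib[OF \<epsilon> xN] FE.hom.regsec_fib[OF s subsetD[OF N(2) xN]]
      unfolding c_def \<epsilon>_def by (simp add: fib_transpose_eq_coord_transpose[OF x iso] coord_transpose_def)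
  qed
  then show "regsec X E (U \<inter> U1) (\<lambda>x. fib_transpose E L x (s x) (of_coords F x (\<Phi> x) (unit_coord k)))"
    unfolding N_def .
qed

lemma ratrep_transpose:
  "s \<in> ratrep X H \<Longrightarrow> (\<lambda>x. fib_transpose E L x (s x)) \<in> ratrep X H"
  unfolding ratrep_def using regsec_transpose by blast

lemma rtranspose_rclass:
  "s \<in> ratrep X H \<Longrightarrow> rtranspose X E L (rclass X H s) = rclass X H (\<lambda>x. fib_transpose E L x (s x))"
  unfolding rtranspose_def by (rule rmap_rclass)

text \<open>Equality is only generic: where a representative leaves the fibre of the Hom bundle, the
  definite description in \<open>fib_transpose\<close> is not controlled.\<close>

lemma gen_eq_transpose_diff:
  assumes "s \<in> ratrep X H" "t \<in> ratrep X H"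
  shows "gen_eq (\<lambda>x. fib_transpose E L x (s x - t x))
           (\<lambda>x. fib_transpose E L x (s x) - fib_transpose E L x (t x))"
proof -
  obtain U U' where *: "zopen X U" "U \<noteq> {}" "regsec X H U s" "zopen X U'" "U' \<noteq> {}" "regsec X H U' t"
    using assms unfolding ratrep_def by blast
  show ?thesis
  proof (rule gen_eqI[OF zopen_Int[OF *(1,4)] zopen_Int_nonempty[OF *(1,2,4,5)]])
    fix x
    assume "x \<in> U \<inter> U'"
    then show "fib_transpose E L x (s x - t x) = fib_transpose E L x (s x) - fib_transpose E L x (t x)"
      using zopen_subset *(1) FE.hom.regsec_fib[OF *(3)] FE.hom.regsec_fib[OF *(6)]
      by (intro fib_transpose_diff) auto
  qed
qed

lemma regular_at_transpose:
  assumes "FE.hom.regular_at x s"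
  shows "FE.hom.regular_at x (\<lambda>y. fib_transpose E L y (s y))"
proof -
  obtain U t where *: "zopen X U" "x \<in> U" "regsec X H U t" "gen_eq s t"
    using assms unfolding FE.hom.regular_at_def by blast
  then show ?thesis
    unfolding FE.hom.regular_at_def
    using regsec_transpose[OF *(1,3)] gen_eq_map2[OF *(4,4), of "\<lambda>x u v. fib_transpose E L x u"]
    by blast
qed

lemma ptranspose_pgerm:
  assumes s: "s \<in> ratrep X H" and x: "x \<in> X" and p: "p x = pgerm X H x (rclass X H s)"
  shows "ptranspose X E L p x = pgerm X H x (rclass X H (\<lambda>y. fib_transpose E L y (s y)))"
proof -
  have "pgerm X H x (rtranspose X E L A) = pgerm X H x (rclass X H (\<lambda>y. fib_transpose E L y (s y)))"
    if A: "A \<in> p x" for A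
  proof -
    obtain t where t: "t \<in> ratrep X H" "A = rclass X H t" "FE.hom.regular_at x (\<lambda>y. t y - s y)"
      by (rule FE.hom.pgermE[OF A[unfolded p] s])
    have "FE.hom.regular_at x (\<lambda>y. fib_transpose E L y (t y) - fib_transpose E L y (s y))"
      by (rule FE.hom.regular_at_cong[OF gen_eq_transpose_diff[OF t(1) s] regular_at_transpose[OF t(3)]])
    then show ?thesis
      unfolding t(2) rtranspose_rclass[OF t(1)]
      using s t(1) x by (simp add: FE.hom.pgerm_eq_iff ratrep_transpose)
  qed
  moreover have "rclass X H s \<in> p x"
    unfolding p using s x by (rule FE.hom.pgerm_self)
  ultimately show ?thesis
    unfolding ptranspose_def using x by auto
qed

end

section \<open>Isotropic subbundles\<close>

context twisted_dual
begin

lemma ptranspose_eq_iff: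
  assumes p: "p \<in> Prin X H" and a: "a \<in> ratrep X H" and b: "b \<in> ratrep X H"
    and H0: "\<And>s x. regsec X H X s \<Longrightarrow> x \<in> X \<Longrightarrow> s x = 0"
    and pa: "pdiff X H (ptranspose X E L p) p = ppart X H (rclass X H a)"
    and q: "q = pdiff X H p (ppart X H (rclass X H b))"
  shows "ptranspose X E L q = q \<longleftrightarrow> gen_eq (\<lambda>x. fib_transpose E L x (b x) - b x - a x) (\<lambda>_. 0)"
proof -
  define d where "d = (\<lambda>x. fib_transpose E L x (b x) - b x - a x)"
  have d: "ptranspose X E L q x = q x \<longleftrightarrow> FE.hom.regular_at x d" if x: "x \<in> X" for x
  proof -
    obtain U s where "zopen X U" "x \<in> U" and s: "s \<in> ratrep X H"
        and "\<And>y. y \<in> U \<Longrightarrow> p y = pgerm X H y (rclass X H s)"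
      by (rule FE.hom.PrinE[OF p x]) blast
    then have px: "p x = pgerm X H x (rclass X H s)"
      by blast
    \<comment> \<open>\<open>r\<close> is regular at \<open>x\<close>: this is the hypothesis
      \<open>pa\<close>, read off on the local lift \<open>s\<close> of \<open>p\<close>.\<close>
    define r where "r = (\<lambda>y. fib_transpose E L y (s y) - s y - a y)"
    note ts = ratrep_transpose[OF s]
    have "pgerm X H x (rclass X H (\<lambda>y. fib_transpose E L y (s y) - s y)) = pgerm X H x (rclass X H a)"
      using FE.hom.pdiff_pgerm[where p = "ptranspose X E L p" and q = p, OF ts s x ptranspose_pgerm[where p = p, OF s x px] px] x
      unfolding pa ppart_def by simp
    then have r: "FE.hom.regular_at x r"
      unfolding r_def using FE.hom.pgerm_eq_iff[OF FE.hom.ratrep_diff[OF ts s] a x] by simp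
    have sb: "(\<lambda>y. s y - b y) \<in> ratrep X H"
      by (rule FE.hom.ratrep_diff[OF s b])
    have qx: "q x = pgerm X H x (rclass X H (\<lambda>y. s y - b y))"
      unfolding q by (rule FE.hom.pdiff_pgerm[where p = p, OF s b x px]) (simp add: ppart_def x)
    have "ptranspose X E L q x = q x \<longleftrightarrow>
        FE.hom.regular_at x (\<lambda>y. fib_transpose E L y (s y - b y) - (s y - b y))"
      unfolding ptranspose_pgerm[where p = q, OF sb x qx] qx
      by (rule FE.hom.pgerm_eq_iff[OF ratrep_transpose[OF sb] sb x])
    \<comment> \<open>Writing t for the transpose, ts - s = r + a and tb - b = d + a, so the lift
      \<open>s - b\<close> of \<open>q\<close> has t(s - b) - (s - b) = r - d generically.\<close>
    also have "\<dots> \<longleftrightarrow> FE.hom.regular_at x (\<lambda>y. r y - d y)"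
    proof -
      have "gen_eq (\<lambda>y. fib_transpose E L y (s y - b y) - (s y - b y)) (\<lambda>y. r y - d y)"
        using gen_eq_map2[OF gen_eq_transpose_diff[OF s b] gen_eq_refl[of "\<lambda>y. s y - b y"], of "\<lambda>_. (-)"]
        unfolding r_def d_def by (simp add: algebra_simps)
      then show ?thesis
        using FE.hom.regular_at_cong gen_eq_sym by blast
    qed
    also have "\<dots> \<longleftrightarrow> FE.hom.regular_at x d"
      using FE.hom.regular_at_diff[OF r, of "\<lambda>y. r y - d y"] FE.hom.regular_at_diff[OF r, of d] by auto
    finally show ?thesis .
  qed
  \<comment> \<open>Both principal parts are extensional, so off \<open>X\<close> they agree by
    convention and only points of \<open>X\<close> have to be compared.\<close>
  have "ptranspose X E L q = q \<longleftrightarrow> (\<forall>x\<in>X. ptranspose X E L q x = q x)"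
  proof -
    have "ptranspose X E L q \<in> extensional X" "q \<in> extensional X"
      unfolding q pdiff_def ptranspose_def by simp_all
    then show ?thesis
      by (metis extensionalityI)
  qed
  also have "\<dots> \<longleftrightarrow> (\<forall>x\<in>X. FE.hom.regular_at x d)"
    using d by blast
  also have "\<dots> \<longleftrightarrow> gen_eq d (\<lambda>_. 0)"
  proof
    assume "\<forall>x\<in>X. FE.hom.regular_at x d"
    then obtain t where t: "regsec X H X t" "gen_eq d t"
      using FE.hom.regular_everywhere by blast
    have "gen_eq t (\<lambda>_. 0)"
      by (rule gen_eqI[OF zopen_self nonempty]) (rule H0[OF t(1)])
    then show "gen_eq d (\<lambda>_. 0)"
      by (rule gen_eq_trans[OF t(2)])
  next
    assume "gen_eq d (\<lambda>_. 0)"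
    then show "\<forall>x\<in>X. FE.hom.regular_at x d"
      using FE.hom.regular_at_cong[OF gen_eq_sym FE.hom.regular_at_zero] by blast
  qed
  finally show ?thesis
    unfolding d_def .
qed

lemma theta_rat_graph:
  assumes a: "a \<in> ratrep X H" and b: "b \<in> ratrep X H" and f: "f \<in> ratrep X F" and g: "g \<in> ratrep X F"
  shows "theta_rat X E L (rclass X H a)
      (rapp X E (rclass X H b) (rclass X F f), rclass X F f)
      (rapp X E (rclass X H b) (rclass X F g), rclass X F g)
    = rclass X L (\<lambda>x. g x ((fib_transpose E L x (b x) - b x - a x) (f x)))"
proof -
  note bf = FE.ratrep_app[OF b f] and bg = FE.ratrep_app[OF b g] and af = FE.ratrep_app[OF a f]
  note fbg = EL.ratrep_app[OF f bg] and gbf = EL.ratrep_app[OF g bf] and gaf = EL.ratrep_app[OF g af]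
  have "theta_rat X E L (rclass X H a)
      (rapp X E (rclass X H b) (rclass X F f), rclass X F f)
      (rapp X E (rclass X H b) (rclass X F g), rclass X F g)
    = rclass X L (\<lambda>x. f x (b x (g x)) - g x (b x (f x)) - g x (a x (f x)))"
    unfolding theta_rat_def
    by (simp add: FE.rapp_rclass[OF a f] FE.rapp_rclass[OF b f] FE.rapp_rclass[OF b g]
        EL.rapp_rclass[OF f bg] EL.rapp_rclass[OF g bf] EL.rapp_rclass[OF g af]
        L.rdiff_rclass[OF fbg gbf] L.rdiff_rclass[OF L.ratrep_diff[OF fbg gbf] gaf])
  also have "\<dots> = rclass X L (\<lambda>x. g x ((fib_transpose E L x (b x) - b x - a x) (f x)))"
  proof (rule rclass_cong)
    \<comment> \<open>The transpose identity is pointwise and needs all four values in their fibres,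
      which holds on the intersection of the open sets where the representatives are
      regular.\<close>
    obtain U1 U2 U3 U4 where *: "zopen X U1" "U1 \<noteq> {}" "regsec X H U1 a" "zopen X U2" "U2 \<noteq> {}" "regsec X H U2 b"
        "zopen X U3" "U3 \<noteq> {}" "regsec X F U3 f" "zopen X U4" "U4 \<noteq> {}" "regsec X F U4 g"
      using a b f g unfolding ratrep_def by blast
    have U: "zopen X (U1 \<inter> U2)" "U1 \<inter> U2 \<noteq> {}" "zopen X (U3 \<inter> U4)" "U3 \<inter> U4 \<noteq> {}"
      using * zopen_Int zopen_Int_nonempty by blast+
    show "gen_eq (\<lambda>x. f x (b x (g x)) - g x (b x (f x)) - g x (a x (f x)))
        (\<lambda>x. g x ((fib_transpose E L x (b x) - b x - a x) (f x)))"
    proof (rule gen_eqI[OF zopen_Int[OF U(1,3)] zopen_Int_nonempty[OF U]])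
      fix x
      assume xU: "x \<in> U1 \<inter> U2 \<inter> (U3 \<inter> U4)"
      then have x: "x \<in> X"
        using zopen_subset U(1) by blast
      have ax: "a x \<in> fib H x" and bx: "b x \<in> fib H x" and fx: "f x \<in> fib F x" and gx: "g x \<in> fib F x"
        using xU FE.hom.regsec_fib[OF *(3)] FE.hom.regsec_fib[OF *(6)]
          EL.hom.regsec_fib[OF *(9)] EL.hom.regsec_fib[OF *(12)] by blast+
      note E = FE.hom_in_fib[OF fib_transpose_in_fib[OF x bx] x fx] FE.hom_in_fib[OF bx x fx]
        FE.hom_in_fib[OF ax x fx]
      have "g x ((fib_transpose E L x (b x) - b x - a x) (f x))
          = g x (fib_transpose E L x (b x) (f x)) - g x (b x (f x)) - g x (a x (f x))"
        by (simp add: EL.hom_diff[OF gx x] E.fib_diff[OF x] E)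
      then show "f x (b x (g x)) - g x (b x (f x)) - g x (a x (f x))
          = g x ((fib_transpose E L x (b x) - b x - a x) (f x))"
        by (simp add: fib_transpose_app[OF x bx gx fx])
    qed
  qed
  finally show ?thesis .
qed

text \<open>Both inclusions in \<open>graph\<close> are used: sections of \<open>G\<close>
  correspond to pairs (b f, f), and conversely each such pair in \<open>Wsheaf\<close> comes from a
  section of \<open>G\<close>. The first shows that d = 0 gives isotropy, the second that isotropy
  gives d = 0.\<close>

lemma isotropic_graph_iff:
  fixes W :: "((complex^'k) set, 'w::ab_group_add) vbundle"
  assumes W: "vector_bundle X W" and \<theta>: "regsec X (hom_bundle W (hom_bundle W L)) X \<theta>"
    and a: "a \<in> ratrep X H" and b: "b \<in> ratrep X H" and p: "p \<in> Prin X H"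
    and form: "form_restricts X E L W (rclass X H a) \<Psi> \<theta>"
    and G: "subbundle X W r G"
    and graph: "\<And>U. zopen X U \<Longrightarrow> U \<noteq> {} \<Longrightarrow>
      \<Psi> ` subsecs X W G U = rgraph X E F (rclass X H b) \<inter> Wsheaf X E F p U"
  shows "isotropic X \<theta> G \<longleftrightarrow> gen_eq (\<lambda>x. fib_transpose E L x (b x) - b x - a x) (\<lambda>_. 0)"
proof -
  interpret W: framed_bundle X W
    by (rule framed_bundle[OF W])
  interpret WL: bundle_pair X W L ..
  interpret WWL: bundle_pair X W "hom_bundle W L" ..
  define d where "d = (\<lambda>x. fib_transpose E L x (b x) - b x - a x)"
  have d: "d \<in> ratrep X H"
    unfolding d_def by (intro FE.hom.ratrep_diff ratrep_transpose a b)
  have form_graph: "rclass X L (\<lambda>x. \<theta> x (s x) (t x)) = rclass X L (\<lambda>x. g x (d x (f x)))"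
    if U: "zopen X U" "U \<noteq> {}" and s: "regsec X W U s" and t: "regsec X W U t"
      and f: "f \<in> ratrep X F" and g: "g \<in> ratrep X F"
      and \<Psi>s: "\<Psi> (rclass X W s) = (rapp X E (rclass X H b) (rclass X F f), rclass X F f)"
      and \<Psi>t: "\<Psi> (rclass X W t) = (rapp X E (rclass X H b) (rclass X F g), rclass X F g)"
    for U s t f g
  proof -
    have "rclass X W s \<in> secs X W U" "rclass X W t \<in> secs X W U"
      using s t unfolding secs_def by blast+
    then have "rmap2 X L \<theta> (rclass X W s) (rclass X W t)
        = theta_rat X E L (rclass X H a) (\<Psi> (rclass X W s)) (\<Psi> (rclass X W t))"
      using form U unfolding form_restricts_def by blast
    then show ?thesis
      unfolding \<Psi>s \<Psi>t theta_rat_graph[OF a b f g] d_def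
        rmap2_rclass[OF ratrepI[OF U s] ratrepI[OF U t]] .
  qed
  \<comment> \<open>The rationality side condition of \<open>rclass_eqD\<close>, each time a class
    in \<open>L\<close> turns out to be zero.\<close>
  have L0: "(\<lambda>_. 0) \<in> ratrep X L"
    by (rule ratrepI[OF zopen_self nonempty L.regsec_zero[OF zopen_self]])
  have "isotropic X \<theta> G" if d0: "gen_eq d (\<lambda>_. 0)"
    unfolding isotropic_def
  proof (intro ballI)
    fix x u v
    assume x: "x \<in> X" and u: "u \<in> G x" and v: "v \<in> G x"
    obtain U \<phi> where U: "x \<in> U" "local_trivialisation X W (U, \<phi>)"
        "\<And>y. y \<in> U \<Longrightarrow> G y = {w \<in> fib W y. \<phi> y w \<in> coords r}"
      using G x unfolding subbundle_def by blast
    have open_U: "zopen X U" and iso: "\<And>y. y \<in> U \<Longrightarrow> fibre_iso W y (\<phi> y)"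
      using U(2) unfolding local_trivialisation_def by auto
    have sub: "coords r \<subseteq> coords (rk W)"
      using G unfolding subbundle_def coords_def by auto
    \<comment> \<open>\<open>w\<close> is extended with constant coordinates in the trivialisation
      adapted to \<open>G\<close>. These stay in \<open>coords r\<close>, so the extension is a
      section of \<open>G\<close> on all of \<open>U\<close>, even if \<open>x\<close> is a pole of
      \<open>\<alpha>\<close> or \<open>\<beta>\<close>.\<close>
    define \<sigma> where "\<sigma> = (\<lambda>w y. of_coords W y (\<phi> y) (\<phi> x w))"
    have \<sigma>: "regsec X W U (\<sigma> w)" "\<sigma> w x = w"
        "\<exists>f\<in>ratrep X F. \<Psi> (rclass X W (\<sigma> w)) = (rapp X E (rclass X H b) (rclass X F f), rclass X F f)"
      if w: "w \<in> G x" for w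
    proof -
      have c: "\<phi> x w \<in> coords r" and wx: "w \<in> fib W x"
        using w U(3)[OF U(1)] by auto
      then have c': "\<phi> x w \<in> coords (rk W)"
        using sub by blast
      show reg: "regsec X W U (\<sigma> w)"
        unfolding \<sigma>_def by (rule regsec_of_const_coords[OF W U(2) c'])
      show "\<sigma> w x = w"
        unfolding \<sigma>_def by (rule W.of_coords_coord[OF x iso[OF U(1)] wx])
      have "\<sigma> w y \<in> G y" if y: "y \<in> U" for y
      proof -
        have "y \<in> X"
          using y open_U zopen_subset by blast
        then show ?thesis
          unfolding U(3)[OF y] \<sigma>_def
          using W.of_coords_in_fib[OF _ iso[OF y] c'] W.coord_of_coords[OF _ iso[OF y] c'] c by simp
      qed
      then have "rclass X W (\<sigma> w) \<in> subsecs X W G U"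
        using reg unfolding subsecs_def by blast
      then have "\<Psi> (rclass X W (\<sigma> w)) \<in> rgraph X E F (rclass X H b)"
        using graph[OF open_U] U(1) by blast
      then show "\<exists>f\<in>ratrep X F. \<Psi> (rclass X W (\<sigma> w))
          = (rapp X E (rclass X H b) (rclass X F f), rclass X F f)"
        unfolding rgraph_def Rat_def by blast
    qed
    obtain f g where f: "f \<in> ratrep X F"
        "\<Psi> (rclass X W (\<sigma> u)) = (rapp X E (rclass X H b) (rclass X F f), rclass X F f)"
      and g: "g \<in> ratrep X F"
        "\<Psi> (rclass X W (\<sigma> v)) = (rapp X E (rclass X H b) (rclass X F g), rclass X F g)"
      using \<sigma>(3)[OF u] \<sigma>(3)[OF v] by blast
    have "gen_eq (\<lambda>y. g y (d y (f y))) (\<lambda>_. 0)"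
    proof -
      obtain U1 U2 where *: "zopen X U1" "U1 \<noteq> {}" "\<forall>y\<in>U1. d y = 0" "zopen X U2" "U2 \<noteq> {}" "regsec X F U2 g"
        using d0 g(1) unfolding gen_eq_def ratrep_def by blast
      show ?thesis
      proof (rule gen_eqI[OF zopen_Int[OF *(1,4)] zopen_Int_nonempty[OF *(1,2,4,5)]])
        fix y
        assume y: "y \<in> U1 \<inter> U2"
        then have "y \<in> X" "g y \<in> fib F y"
          using zopen_subset *(1) EL.hom.regsec_fib[OF *(6)] by blast+
        then show "g y (d y (f y)) = 0"
          using y *(3) EL.hom_zero by simp
      qed
    qed
    then have "rclass X L (\<lambda>y. \<theta> y (\<sigma> u y) (\<sigma> v y)) = rclass X L (\<lambda>_. 0)"
      using form_graph[OF open_U _ \<sigma>(1)[OF u] \<sigma>(1)[OF v] f(1) g(1) f(2) g(2)] U(1) rclass_cong by force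
    then have "gen_eq (\<lambda>y. \<theta> y (\<sigma> u y) (\<sigma> v y)) (\<lambda>_. 0)"
      using L0 by (rule rclass_eqD)
    \<comment> \<open>The pairing is regular on the whole of \<open>U\<close> although the formula
      with \<open>d\<close> is only generic, so its generic vanishing extends to
      \<open>x\<close>.\<close>
    moreover have "regsec X L U (\<lambda>y. \<theta> y (\<sigma> u y) (\<sigma> v y))"
      using open_U zopen_subset
      by (intro WL.regsec_hom_app[OF open_U WWL.regsec_hom_app[OF open_U]] \<sigma>(1) u v
          WWL.hom.regsec_restrict[OF \<theta> open_U]) auto
    ultimately have "\<theta> x (\<sigma> u x) (\<sigma> v x) = 0"
      using L.gen_eq_regsec[OF open_U _ L.regsec_zero[OF open_U] _ U(1)] by blast
    then show "\<theta> x u v = 0"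
      by (simp add: \<sigma>(2) u v)
  qed
  moreover have "gen_eq d (\<lambda>_. 0)" if iso: "isotropic X \<theta> G"
  proof -
    obtain x0 where "x0 \<in> X"
      using nonempty by blast
    obtain U1 s where U1: "zopen X U1" "x0 \<in> U1" and s: "s \<in> ratrep X H"
        and ps: "\<And>y. y \<in> U1 \<Longrightarrow> p y = pgerm X H y (rclass X H s)"
      by (rule FE.hom.PrinE[OF p \<open>x0 \<in> X\<close>]) blast
    obtain U2 U3 U4 where *: "zopen X U2" "U2 \<noteq> {}" "regsec X H U2 s" "zopen X U3" "U3 \<noteq> {}" "regsec X H U3 b"
        "zopen X U4" "U4 \<noteq> {}" "regsec X H U4 d"
      using s b d unfolding ratrep_def by blast
    \<comment> \<open>On \<open>U1\<close> one rational \<open>s\<close> lifts every germ of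
      \<open>p\<close>; \<open>U\<close> is cut down further so that \<open>s\<close>,
      \<open>b\<close> and \<open>d\<close> are all regular on it.\<close>
    define U where "U = U1 \<inter> U2 \<inter> (U3 \<inter> U4)"
    have U12: "zopen X (U1 \<inter> U2)" "U1 \<inter> U2 \<noteq> {}" and U34: "zopen X (U3 \<inter> U4)" "U3 \<inter> U4 \<noteq> {}"
      using U1 * by (auto intro!: zopen_Int dest: zopen_Int_nonempty)
    have U: "zopen X U" "U \<noteq> {}" "U \<subseteq> U1" "U \<subseteq> U2" "U \<subseteq> U3" "U \<subseteq> U4"
      unfolding U_def using zopen_Int[OF U12(1) U34(1)] zopen_Int_nonempty[OF U12 U34] by auto
    have lift: "\<exists>\<sigma>. regsec X W N \<sigma> \<and> (\<forall>y\<in>N. \<sigma> y \<in> G y) \<and>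
        \<Psi> (rclass X W \<sigma>) = (rapp X E (rclass X H b) (rclass X F f), rclass X F f)"
      if N: "zopen X N" "N \<subseteq> U" "N \<noteq> {}" and f: "regsec X F N f" for N f
    proof -
      have fr: "f \<in> ratrep X F"
        by (rule ratrepI[OF N(1,3) f])
      have "(rapp X E (rclass X H b) (rclass X F f), rclass X F f) \<in> Wsheaf X E F p N"
        unfolding Wsheaf_def
      proof (intro CollectI case_prodI conjI ballI)
        show "rapp X E (rclass X H b) (rclass X F f) \<in> Rat X E"
          unfolding FE.rapp_rclass[OF b fr] by (intro rclass_in_Rat FE.ratrep_app b fr)
        show "rclass X F f \<in> secs X F N"
          using f unfolding secs_def by blast
        fix y
        assume y: "y \<in> N"
        then have yX: "y \<in> X"
          using N(1) zopen_subset by blast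
        have "papp X E p (rclass X F f) y = pgerm X E y (rclass X E (\<lambda>z. s z (f z)))"
          by (rule FE.papp_pgerm[where p = p, OF s fr yX ps EL.hom.regular_atI[OF N(1) y f]]) (use y N U in blast)
        \<comment> \<open>The condition in \<open>Wsheaf\<close> compares the principal parts of
          b(f) and s(f). Both are regular on \<open>N\<close>, so it holds for every regular
          \<open>f\<close>.\<close>
        moreover have "regsec X E N (\<lambda>z. b z (f z) - s z (f z))"
          using N U
          by (intro E.regsec_diff FE.regsec_hom_app[OF N(1) _ f] FE.hom.regsec_restrict[OF *(3)]
              FE.hom.regsec_restrict[OF *(6)]) auto
        then have "pgerm X E y (rclass X E (\<lambda>z. b z (f z))) = pgerm X E y (rclass X E (\<lambda>z. s z (f z)))"
          using E.pgerm_eq_iff[OF FE.ratrep_app[OF b fr] FE.ratrep_app[OF s fr] yX]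
            E.regular_atI[OF N(1) y] by blast
        ultimately show "ppart X E (rapp X E (rclass X H b) (rclass X F f)) y = papp X E p (rclass X F f) y"
          unfolding FE.rapp_rclass[OF b fr] ppart_def using yX by simp
      qed
      moreover have "(rapp X E (rclass X H b) (rclass X F f), rclass X F f) \<in> rgraph X E F (rclass X H b)"
        unfolding rgraph_def using rclass_in_Rat[OF fr] by blast
      ultimately have "(rapp X E (rclass X H b) (rclass X F f), rclass X F f) \<in> \<Psi> ` subsecs X W G N"
        using graph[OF N(1,3)] by blast
      then show ?thesis
        unfolding subsecs_def by force
    qed
    show ?thesis
    proof (rule gen_eqI[OF U(1,2)])
      fix x
      assume xU: "x \<in> U"
      then have x: "x \<in> X" and dx: "d x \<in> fib H x"
        using U zopen_subset FE.hom.regsec_fib[OF *(9)] by blast+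
      obtain \<phi> \<psi> where iso_x: "fibre_iso E x \<phi>" "fibre_iso L x \<psi>"
        by (rule fibre_isos[OF x])
      \<comment> \<open>The vectors \<open>f\<close> and \<open>g\<close> are extended to regular
        sections \<open>f'\<close> and \<open>g'\<close>, which \<open>lift\<close> turns into
        sections of \<open>G\<close>. Isotropy makes g'(d(f')) vanish generically, and regularity on
        \<open>N\<close> gives the value at \<open>x\<close>.\<close>
      have zero: "g (d x f) = 0" if f: "f \<in> fib F x" and g: "g \<in> fib F x" for f g
      proof -
        obtain N1 f' where f': "zopen X N1" "x \<in> N1" "regsec X F N1 f'" "f' x = f"
          by (rule EL.hom.regsec_through_point[OF x f])
        obtain N2 g' where g': "zopen X N2" "x \<in> N2" "regsec X F N2 g'" "g' x = g"
          by (rule EL.hom.regsec_through_point[OF x g])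
        define N where "N = U \<inter> (N1 \<inter> N2)"
        have N: "zopen X N" "x \<in> N" "N \<noteq> {}" "N \<subseteq> U" "N \<subseteq> N1" "N \<subseteq> N2"
          unfolding N_def using zopen_Int[OF U(1) zopen_Int[OF f'(1) g'(1)]] xU f'(2) g'(2) by auto
        note fN = EL.hom.regsec_restrict[OF f'(3) N(1,5)] and gN = EL.hom.regsec_restrict[OF g'(3) N(1,6)]
        obtain \<sigma> \<tau> where \<sigma>: "regsec X W N \<sigma>" "\<forall>y\<in>N. \<sigma> y \<in> G y"
            "\<Psi> (rclass X W \<sigma>) = (rapp X E (rclass X H b) (rclass X F f'), rclass X F f')"
          and \<tau>: "regsec X W N \<tau>" "\<forall>y\<in>N. \<tau> y \<in> G y"
            "\<Psi> (rclass X W \<tau>) = (rapp X E (rclass X H b) (rclass X F g'), rclass X F g')"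
          using lift[OF N(1,4,3) fN] lift[OF N(1,4,3) gN] by blast
        have "gen_eq (\<lambda>y. \<theta> y (\<sigma> y) (\<tau> y)) (\<lambda>_. 0)"
          by (rule gen_eqI[OF N(1,3)])
            (use iso \<sigma>(2) \<tau>(2) zopen_subset[OF N(1)] in \<open>auto simp: isotropic_def\<close>)
        then have "rclass X L (\<lambda>y. g' y (d y (f' y))) = rclass X L (\<lambda>_. 0)"
          using form_graph[OF N(1,3) \<sigma>(1) \<tau>(1) ratrepI[OF N(1,3) fN] ratrepI[OF N(1,3) gN] \<sigma>(3) \<tau>(3)]
            rclass_cong by force
        then have "gen_eq (\<lambda>y. g' y (d y (f' y))) (\<lambda>_. 0)"
          using L0 by (rule rclass_eqD)
        moreover have "regsec X L N (\<lambda>y. g' y (d y (f' y)))"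
          using N(4) U(6)
          by (intro EL.regsec_hom_app[OF N(1) gN] FE.regsec_hom_app[OF N(1) _ fN]
              FE.hom.regsec_restrict[OF *(9) N(1)]) auto
        ultimately have "g' x (d x (f' x)) = 0"
          using L.gen_eq_regsec[OF N(1) _ L.regsec_zero[OF N(1)] _ N(2)] by blast
        then show ?thesis
          unfolding f'(4) g'(4) .
      qed
      \<comment> \<open>Equality as functions on the whole type: on the fibre it follows from
        \<open>dual_separates\<close>, off the fibre from the zero convention of
        \<open>hom_bundle\<close>.\<close>
      show "d x = 0"
      proof
        fix f
        show "d x f = 0 f"
        proof (cases "f \<in> fib F x")
          case True
          have "d x f = 0"
            by (rule dual_separates[OF x iso_x FE.hom_in_fib[OF dx x True] E.fib_zero[OF x]])
              (simp add: zero[OF True] EL.hom_zero[OF _ x])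
          then show ?thesis
            by simp
        next
          case False
          then show ?thesis
            using FE.hom_outside[OF dx x] by simp
        qed
      qed
    qed
  qed
  ultimately show ?thesis
    unfolding d_def by blast
qed

end

theorem mainTheorem6:
  fixes X :: "(complex^'k) set set"
    and E :: "((complex^'k) set, 'e::ab_group_add) vbundle"
    and L :: "((complex^'k) set, 'l::ab_group_add) vbundle"
    and W :: "((complex^'k) set, 'w::ab_group_add) vbundle"
    and F :: "((complex^'k) set, 'e \<Rightarrow> 'l) vbundle"
    and H :: "((complex^'k) set, ('e \<Rightarrow> 'l) \<Rightarrow> 'e) vbundle"
    and n :: nat
    and \<iota> :: "(complex^'k) set \<Rightarrow> 'e \<Rightarrow> 'w"
    and \<pi> :: "(complex^'k) set \<Rightarrow> 'w \<Rightarrow> 'e \<Rightarrow> 'l"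
    and \<theta> :: "(complex^'k) set \<Rightarrow> 'w \<Rightarrow> 'w \<Rightarrow> 'l"
    and p q :: "(complex^'k) set \<Rightarrow> ((complex^'k) set \<Rightarrow> ('e \<Rightarrow> 'l) \<Rightarrow> 'e) set set"
    and \<alpha> \<beta> :: "((complex^'k) set \<Rightarrow> ('e \<Rightarrow> 'l) \<Rightarrow> 'e) set"
    and \<Psi> :: "((complex^'k) set \<Rightarrow> 'w) set \<Rightarrow>
        ((complex^'k) set \<Rightarrow> 'e) set \<times> ((complex^'k) set \<Rightarrow> 'e \<Rightarrow> 'l) set"
    and G :: "(complex^'k) set \<Rightarrow> 'w set"
  assumes "smooth_projective_curve X"
    and "vector_bundle X E" "rk E = n"
    and "vector_bundle X L" "rk L = 1"
    and "F = hom_bundle E L" "H = hom_bundle F E"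
    and "\<forall>s. regsec X H X s \<longrightarrow> (\<forall>x\<in>X. s x = 0)"
    and "symplectic_extension X E L W \<iota> \<pi> \<theta>"
    and "p \<in> Prin X H"
    and "\<alpha> \<in> RatAlt X E L"
    and "pdiff X H (ptranspose X E L p) p = ppart X H \<alpha>"
    and "has_sheaf_Wp X E W F \<iota> \<pi> p \<Psi>"
    and "form_restricts X E L W \<alpha> \<Psi> \<theta>"
    and "subbundle X W n G"
    and "\<exists>U. zopen X U \<and> U \<noteq> {} \<and> (\<forall>x\<in>U. G x \<inter> \<iota> x ` fib E x = {0})"
    and "\<beta> \<in> Rat X H"
    and "\<forall>U. zopen X U \<and> U \<noteq> {} \<longrightarrow>
           \<Psi> ` subsecs X W G U = rgraph X E F \<beta> \<inter> Wsheaf X E F p U"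
    and "q = pdiff X H p (ppart X H \<beta>)"
  shows "isotropic X \<theta> G \<longleftrightarrow> ptranspose X E L q = q"
proof -
  interpret projective_variety X
    using assms(1) unfolding smooth_projective_curve_def by unfold_locales auto
  interpret E: framed_bundle X E
    by (rule framed_bundle[OF assms(2)])
  interpret L: framed_bundle X L
    by (rule framed_bundle[OF assms(4)])
  interpret twisted_dual X E L
    by unfold_locales (rule assms(5))
  \<comment> \<open>\<open>F\<close> and \<open>H\<close> are variables of the statement; replacing
    them by the Hom bundles matches the hypotheses with the facts of
    \<open>twisted_dual\<close>.\<close>
  have FH: "F = hom_bundle E L" "H = hom_bundle (hom_bundle E L) E"
    using assms(6,7) by simp_all
  note assms = assms[unfolded FH]
  obtain a where a: "a \<in> ratrep X (hom_bundle (hom_bundle E L) E)"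
      "\<alpha> = rclass X (hom_bundle (hom_bundle E L) E) a"
    using assms(11) unfolding RatAlt_def by (blast elim: RatE)
  obtain b where b: "b \<in> ratrep X (hom_bundle (hom_bundle E L) E)"
      "\<beta> = rclass X (hom_bundle (hom_bundle E L) E) b"
    by (rule RatE[OF assms(17)])
  have W: "vector_bundle X W" "regsec X (hom_bundle W (hom_bundle W L)) X \<theta>"
    using assms(9) unfolding symplectic_extension_def symplectic_form_def by blast+
  have "isotropic X \<theta> G \<longleftrightarrow> gen_eq (\<lambda>x. fib_transpose E L x (b x) - b x - a x) (\<lambda>_. 0)"
    by (rule isotropic_graph_iff[OF W a(1) b(1) assms(10) assms(14)[unfolded a(2)] assms(15)])
      (use assms(18) b(2) in blast)
  also have "\<dots> \<longleftrightarrow> ptranspose X E L q = q"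
    by (rule ptranspose_eq_iff[OF assms(10) a(1) b(1) _ assms(12)[unfolded a(2)]
          assms(19)[unfolded b(2)], symmetric])
      (use assms(8) in blast)
  finally show ?thesis .
qed

end
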